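(* Let $\Gamma := \mathrm{SL}_2(\mathbb{Z}[1/2])$, and let $\widetilde\Gamma$ be the preimage of $\Gamma\subset \mathrm{SL}_2(\mathbb{R})$ under the universal covering homomorphism $\widetilde{\mathrm{SL}}_2(\mathbb{R})\to\mathrm{SL}_2(\mathbb{R})$. Then: (1) $\widetilde\Gamma$ is finitely presented; (2) $H_1(\widetilde\Gamma;\mathbb{Z})$ is finite; (3) $H_2(\widetilde\Gamma;\mathbb{R})\cong 0$.
   Context: $\widetilde\Gamma$ is the central extension of $\Gamma$ by $\mathbb{Z}$ corresponding to the integral Euler class of $\Gamma$. *)

theory Defs
  imports Complex_Main "HOL-Algebra.Generated_Groups"
begin

definition dyadic :: "real set" where
  "dyadic = {x. \<exists>m::int. \<exists>k::nat. x = real_of_int m / 2 ^ k}"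

text \<open>The universal cover of SL2(R) is realised as the group (under composition)
of all continuous lifts f : R -> R (angle coordinate, S^1 = R / 2 pi Z) of the action of
matrices A in SL2(R) on the circle of rays v |-> A v / |A v|.  A function f is a lift of
A = [[a,b],[c,d]] iff (cos (f t), sin (f t)) is a positive multiple of A (cos t, sin t).
The covering homomorphism sends f to A.  Gamma-tilde is the preimage of SL2(Z[1/2]).\<close>
definition lifts_matrix :: "real \<Rightarrow> real \<Rightarrow> real \<Rightarrow> real \<Rightarrow> (real \<Rightarrow> real) \<Rightarrow> bool" where
  "lifts_matrix a b c d f \<longleftrightarrow> continuous_on UNIV f \<and>
     (\<forall>t. \<exists>r>0. a * cos t + b * sin t = r * cos (f t) \<and> c * cos t + d * sin t = r * sin (f t))"

definition Gamma_tilde :: "(real \<Rightarrow> real) monoid" where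
  "Gamma_tilde = \<lparr> carrier = {f. \<exists>a b c d. a \<in> dyadic \<and> b \<in> dyadic \<and> c \<in> dyadic \<and> d \<in> dyadic
                         \<and> a * d - b * c = 1 \<and> lifts_matrix a b c d f},
                   mult = (\<lambda>f g. f \<circ> g), one = id \<rparr>"

text \<open>Words over an alphabet: letters (s, True) = s, (s, False) = s^-1.
pres_eq R is the congruence on words defining the group presented by generators and relators R.\<close>
inductive pres_eq :: "('a \<times> bool) list set \<Rightarrow> ('a \<times> bool) list \<Rightarrow> ('a \<times> bool) list \<Rightarrow> bool"
  for R where
  refl: "pres_eq R w w"
| sym: "pres_eq R u v \<Longrightarrow> pres_eq R v u"
| trans: "pres_eq R u v \<Longrightarrow> pres_eq R v w \<Longrightarrow> pres_eq R u w"
| ctxt: "pres_eq R u v \<Longrightarrow> pres_eq R (p @ u @ q) (p @ v @ q)"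
| cancel: "pres_eq R [(s, b), (s, \<not> b)] []"
| rel: "r \<in> R \<Longrightarrow> pres_eq R r []"

definition word_eval :: "('a, 'b) monoid_scheme \<Rightarrow> ('a \<times> bool) list \<Rightarrow> 'a" where
  "word_eval G w = foldr (\<lambda>(s, b) x. (if b then s else inv\<^bsub>G\<^esub> s) \<otimes>\<^bsub>G\<^esub> x) w \<one>\<^bsub>G\<^esub>"

definition finitely_presented :: "('a, 'b) monoid_scheme \<Rightarrow> bool" where
  "finitely_presented G \<longleftrightarrow> (\<exists>S R. finite S \<and> S \<subseteq> carrier G \<and> finite R \<and>
      (\<forall>r\<in>R. set r \<subseteq> S \<times> UNIV) \<and> generate G S = carrier G \<and>
      (\<forall>w. set w \<subseteq> S \<times> UNIV \<longrightarrow> (word_eval G w = \<one>\<^bsub>G\<^esub> \<longleftrightarrow> pres_eq R w [])))"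

definition bar_chains :: "('a, 'b) monoid_scheme \<Rightarrow> nat \<Rightarrow> ('a list \<Rightarrow> 'm::ab_group_add) set" where
  "bar_chains G n = {c. finite {xs. c xs \<noteq> 0} \<and>
      (\<forall>xs. c xs \<noteq> 0 \<longrightarrow> length xs = n \<and> set xs \<subseteq> carrier G)}"

definition bar_face :: "('a, 'b) monoid_scheme \<Rightarrow> nat \<Rightarrow> 'a list \<Rightarrow> 'a list" where
  "bar_face G i xs = (if i = 0 then tl xs else if i = length xs then butlast xs
     else take (i - 1) xs @ [xs ! (i - 1) \<otimes>\<^bsub>G\<^esub> xs ! i] @ drop (i + 1) xs)"

definition bar_boundary :: "('a, 'b) monoid_scheme \<Rightarrow> ('a list \<Rightarrow> 'm::ab_group_add) \<Rightarrow> 'a list \<Rightarrow> 'm" where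
  "bar_boundary G c = (\<lambda>ys. \<Sum>xs\<in>{xs. c xs \<noteq> 0}. \<Sum>i\<in>{0..length xs}.
      if bar_face G i xs = ys then (if even i then c xs else - c xs) else 0)"

definition bar_cycles :: "('a, 'b) monoid_scheme \<Rightarrow> nat \<Rightarrow> ('a list \<Rightarrow> 'm::ab_group_add) set" where
  "bar_cycles G n = {c \<in> bar_chains G n. n = 0 \<or> bar_boundary G c = (\<lambda>_. 0)}"

definition bar_boundaries :: "('a, 'b) monoid_scheme \<Rightarrow> nat \<Rightarrow> ('a list \<Rightarrow> 'm::ab_group_add) set" where
  "bar_boundaries G n = bar_boundary G ` bar_chains G (Suc n)"

text \<open>H_n(G; M) for trivial coefficients M (the coefficient group is the type 'm),
as the set of cosets Z_n / B_n.\<close>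
definition group_homology :: "('a, 'b) monoid_scheme \<Rightarrow> nat \<Rightarrow> ('a list \<Rightarrow> 'm::ab_group_add) set set" where
  "group_homology G n = bar_cycles G n //
     {(c, d). c \<in> bar_cycles G n \<and> d \<in> bar_cycles G n \<and> c - d \<in> bar_boundaries G n}"

end

theory Submission
  imports Defs "HOL-Analysis.Further_Topology" "HOL-Library.Function_Algebras"
begin

text \<open>
  Let \<open>p\<close> be the lift of \<open>((1, 1/2), (0, 1))\<close> that fixes the angle \<open>0\<close> and \<open>q\<close> the lift of
  \<open>((1, 0), (-1, 1))\<close> that fixes \<open>\<pi>/2\<close>. The group is presented by
  \<open>\<langle>p, q | p\<^sup>2 q p\<^sup>2 = q p\<^sup>2 q, p q\<^sup>2 p = q\<^sup>2 p q\<^sup>2\<rangle>\<close>: it is the amalgam of the two braid groups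
  \<open>\<langle>p\<^sup>2, q\<rangle>\<close> and \<open>\<langle>p, q\<^sup>2\<rangle>\<close> along \<open>C = \<langle>p\<^sup>2, q\<^sup>2\<rangle>\<close>, the preimage of \<open>\<Gamma>\<^sub>0(2)\<close>. A 2-adic ping-pong
  shows that a relation between \<open>p\<close> and \<open>q\<close> lies in \<open>C\<close> modulo the two relators, and a real
  ping-pong for \<open>P\<Gamma>\<^sub>0(2) = \<int> * \<int>/2\<close> shows that it is then trivial.

  The abelianised relators \<open>2p = q\<close> and \<open>p = 2q\<close> form a square matrix of determinant \<open>-3\<close>.
  Hence \<open>H\<^sub>1\<close> has at most three elements. It also follows that every central extension by \<open>\<real>\<close> splits,
  because arbitrary lifts of \<open>p\<close> and \<open>q\<close> can be corrected by central elements so as to satisfy the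
  relators; since a real 2-cycle that is not a boundary would be detected by some real 2-cocycle,
  \<open>H\<^sub>2\<close> with real coefficients vanishes.
\<close>

section \<open>Lifts of matrices\<close>

text \<open>Both relators come from one fact: for x * y = 1 with x > 0 the unipotents with upper
  entry x and lower entry -y lift to a braid pair. It is used for (x, y) = (1, 1) and (1/2, 2); the
  sign of the lower entry makes the common product a rotation. Passing to the universal cover is
  what balances the presentation: \<open>t = (p^2 q^2)^2\<close> is the rotation by -pi and has
  infinite order there, so no further relator has to kill a power of it.

  That two relators suffice is proved in the abstract group which they define. There, reduced forms
  are derived from the relators alone, and the map to real functions shows that a nontrivial one is
  not the identity. Three kinds of information are used in turn. Denominators of matrix entries grow
  along the alternating products, which settles everything outside \<open>C\<close>. The matrices of
  \<open>C\<close> are integral, so there the action on the real projective line takes over. It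
  leaves powers of \<open>t\<close> and \<open>p^2\<close>; as \<open>t^2\<close> lifts the identity
  matrix, only the angle itself can exclude these powers of \<open>t\<close>.\<close>

lemma lifts_matrix_id: "lifts_matrix 1 0 0 1 id"
  unfolding lifts_matrix_def by (auto intro!: exI[of _ 1] simp: id_def)

lemma lifts_matrix_comp:
  assumes f: "lifts_matrix a b c d f" and g: "lifts_matrix a' b' c' d' g"
  shows "lifts_matrix (a*a'+b*c') (a*b'+b*d') (c*a'+d*c') (c*b'+d*d') (f \<circ> g)"
  unfolding lifts_matrix_def
proof (intro conjI allI)
  show "continuous_on UNIV (f \<circ> g)"
    using f g by (metis continuous_on_compose continuous_on_subset lifts_matrix_def top_greatest)
  fix t
  obtain r where r: "r > 0" "a' * cos t + b' * sin t = r * cos (g t)" "c' * cos t + d' * sin t = r * sin (g t)"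
    using g unfolding lifts_matrix_def by blast
  obtain s where s: "s > 0" "a * cos (g t) + b * sin (g t) = s * cos (f (g t))"
      "c * cos (g t) + d * sin (g t) = s * sin (f (g t))"
    using f unfolding lifts_matrix_def by blast
  have "(a*a'+b*c') * cos t + (a*b'+b*d') * sin t = a * (a' * cos t + b' * sin t) + b * (c' * cos t + d' * sin t)"
    by (simp add: algebra_simps)
  also have "\<dots> = r * (a * cos (g t) + b * sin (g t))"
    unfolding r by (simp add: algebra_simps)
  also have "\<dots> = (r * s) * cos ((f \<circ> g) t)" unfolding s by simp
  finally have 1: "(a*a'+b*c') * cos t + (a*b'+b*d') * sin t = (r * s) * cos ((f \<circ> g) t)" .
  have "(c*a'+d*c') * cos t + (c*b'+d*d') * sin t = c * (a' * cos t + b' * sin t) + d * (c' * cos t + d' * sin t)"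
    by (simp add: algebra_simps)
  also have "\<dots> = r * (c * cos (g t) + d * sin (g t))"
    unfolding r by (simp add: algebra_simps)
  also have "\<dots> = (r * s) * sin ((f \<circ> g) t)" unfolding s by simp
  finally have 2: "(c*a'+d*c') * cos t + (c*b'+d*d') * sin t = (r * s) * sin ((f \<circ> g) t)" .
  show "\<exists>\<rho>>0. (a*a'+b*c') * cos t + (a*b'+b*d') * sin t = \<rho> * cos ((f \<circ> g) t) \<and>
      (c*a'+d*c') * cos t + (c*b'+d*d') * sin t = \<rho> * sin ((f \<circ> g) t)"
    using 1 2 r(1) s(1) by (intro exI[of _ "r * s"]) auto
qed

lemma polar_eq_imp_angle_eq:
  fixes r s x y :: real
  assumes "r > 0" "s > 0" "r * cos x = s * cos y" "r * sin x = s * sin y"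
  shows "\<exists>k::int. x = y + 2 * pi * k"
proof -
  have "r\<^sup>2 = (r * cos x)\<^sup>2 + (r * sin x)\<^sup>2"
    by (simp add: power_mult_distrib flip: distrib_left)
  also have "\<dots> = s\<^sup>2"
    unfolding assms by (simp add: power_mult_distrib flip: distrib_left)
  finally have "r = s" using assms(1,2) by (simp add: power2_eq_iff)
  then show ?thesis using assms sin_cos_eq_iff[of x y] by auto
qed

lemma lifts_matrix_value:
  assumes f: "lifts_matrix a b c d f" and "r > 0"
    and "a * cos t + b * sin t = r * cos s" "c * cos t + d * sin t = r * sin s"
  obtains k :: int where "f t = s + 2 * pi * k"
proof -
  obtain r' where "r' > 0" "a * cos t + b * sin t = r' * cos (f t)" "c * cos t + d * sin t = r' * sin (f t)"
    using f unfolding lifts_matrix_def by blast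
  then show ?thesis using assms polar_eq_imp_angle_eq[of r' r "f t" s] that by auto
qed

text \<open>The matrix fixes the angle up to multiples of 2 pi, so a crude a priori bound is enough
  to compute a value exactly. The values behind the braid relations are found in this way.\<close>

lemma lifts_matrix_value_eq:
  assumes "lifts_matrix a b c d f" "r > 0"
    and "a * cos t + b * sin t = r * cos s" "c * cos t + d * sin t = r * sin s"
    and "\<bar>f t - s\<bar> < 2 * pi"
  shows "f t = s"
proof -
  obtain k :: int where k: "f t = s + 2 * pi * k" using lifts_matrix_value[OF assms(1-4)] .
  with assms(5) have "\<bar>real_of_int k\<bar> < 1" by (simp add: abs_mult)
  then have "k = 0" by linarith
  with k show ?thesis by simp
qed

text \<open>The difference of two lifts is continuous and takes values in the discrete set 2 pi Z,
  so it is constant.\<close>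

lemma lifts_matrix_unique:
  assumes f: "lifts_matrix a b c d f" and g: "lifts_matrix a b c d g"
  obtains k :: int where "\<And>t. f t = g t + 2 * pi * k"
proof -
  have ex: "\<exists>k::int. f t = g t + 2 * pi * k" for t
  proof -
    obtain r where "r > 0" "a * cos t + b * sin t = r * cos (g t)" "c * cos t + d * sin t = r * sin (g t)"
      using g unfolding lifts_matrix_def by blast
    then show ?thesis using lifts_matrix_value[OF f] by metis
  qed
  have "(\<lambda>t. f t - g t) constant_on UNIV"
  proof (rule continuous_discrete_range_constant)
    show "continuous_on UNIV (\<lambda>t. f t - g t)"
      using f g by (auto intro!: continuous_intros simp: lifts_matrix_def)
    fix x
    show "\<exists>e>0. \<forall>y. y \<in> UNIV \<and> f y - g y \<noteq> f x - g x \<longrightarrow> e \<le> norm (f y - g y - (f x - g x))"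
    proof (intro exI[of _ "2 * pi"] conjI allI impI)
      fix y assume ne: "y \<in> UNIV \<and> f y - g y \<noteq> f x - g x"
      obtain k l :: int where kl: "f x = g x + 2 * pi * k" "f y = g y + 2 * pi * l" using ex by metis
      then have "k \<noteq> l" using ne by auto
      then have "1 \<le> \<bar>real_of_int l - k\<bar>" by linarith
      then have "2 * pi * 1 \<le> 2 * pi * \<bar>real_of_int l - k\<bar>" by (intro mult_left_mono) auto
      also have "\<dots> = norm (f y - g y - (f x - g x))"
        using kl by (simp add: abs_mult flip: right_diff_distrib)
      finally show "2 * pi \<le> norm (f y - g y - (f x - g x))" by simp
    qed simp
  qed simp
  then obtain D where D: "\<And>t. f t - g t = D" unfolding constant_on_def by auto
  obtain k :: int where "f 0 = g 0 + 2 * pi * k" using ex by blast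
  then have "f t = g t + 2 * pi * k" for t using D[of t] D[of 0] by simp
  then show ?thesis using that by blast
qed

text \<open>Equations between lifts thus split into a matrix identity and a comparison at one
  convenient angle.\<close>

lemma lifts_matrix_eqI:
  assumes "lifts_matrix a b c d f" "lifts_matrix a b c d g" "f t = g t"
  shows "f = g"
proof -
  obtain k :: int where k: "\<And>t. f t = g t + 2 * pi * k" using lifts_matrix_unique[OF assms(1,2)] by blast
  then have "k = 0" using assms(3) by auto
  with k show ?thesis by auto
qed

lemma lifts_matrix_shift:
  assumes "lifts_matrix a b c d f"
  shows "lifts_matrix a b c d (\<lambda>t. f t + 2 * pi * real_of_int k)"
proof -
  have "sin (x + 2 * pi * k) = sin x \<and> cos (x + 2 * pi * k) = cos x" for x
    using sin_cos_eq_iff[of "x + 2 * pi * k" x] by blast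
  then show ?thesis using assms by (auto simp: lifts_matrix_def intro!: continuous_intros)
qed

text \<open>The image of the unit circle, read as a curve in the punctured complex plane, has a
  continuous logarithm because the real line is contractible. Its imaginary part is the
  lift.\<close>

lemma lifts_matrix_exists:
  assumes "a * d - b * c = (1::real)"
  obtains f where "lifts_matrix a b c d f"
proof -
  define F where "F = (\<lambda>t::real. Complex (a * cos t + b * sin t) (c * cos t + d * sin t))"
  have "F t \<noteq> 0" for t
  proof
    assume "F t = 0"
    then have 1: "a * cos t + b * sin t = 0" and 2: "c * cos t + d * sin t = 0"
      by (auto simp: F_def complex_eq_iff)
    have "d * (a * cos t + b * sin t) - b * (c * cos t + d * sin t) = (a * d - b * c) * cos t"
      "a * (c * cos t + d * sin t) - c * (a * cos t + b * sin t) = (a * d - b * c) * sin t"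
      by (simp_all add: algebra_simps)
    then have "cos t = 0" "sin t = 0" unfolding 1 2 assms by simp_all
    then show False using sin_cos_squared_add[of t] by simp
  qed
  moreover have "continuous_on UNIV F" unfolding F_def Complex_eq by (intro continuous_intros)
  ultimately obtain g where g: "continuous_on UNIV g" "\<And>x. F x = exp (g x)"
    using continuous_logarithm_on_contractible[of UNIV F] convex_imp_contractible[OF convex_UNIV] by (metis UNIV_I)
  have "lifts_matrix a b c d (\<lambda>t. Im (g t))"
    unfolding lifts_matrix_def
  proof (intro conjI allI)
    show "continuous_on UNIV (\<lambda>t. Im (g t))" using g(1) by (intro continuous_intros)
    fix t
    have "Re (F t) = exp (Re (g t)) * cos (Im (g t))" "Im (F t) = exp (Re (g t)) * sin (Im (g t))"
      unfolding g(2) by (simp_all add: Re_exp Im_exp)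
    then show "\<exists>r>0. a * cos t + b * sin t = r * cos (Im (g t)) \<and> c * cos t + d * sin t = r * sin (Im (g t))"
      by (intro exI[of _ "exp (Re (g t))"]) (auto simp: F_def)
  qed
  then show ?thesis using that by blast
qed

text \<open>Every ray is fixed. The rays at 0, pi/2 and pi/4 force a positive scalar matrix, and the
  determinant makes the scalar 1.\<close>

lemma lifts_matrix_id_imp:
  assumes "lifts_matrix a b c d id" "a * d - b * c = 1"
  shows "a = 1 \<and> b = 0 \<and> c = 0 \<and> d = 1"
proof -
  have *: "\<exists>r>0. a * cos t + b * sin t = r * cos t \<and> c * cos t + d * sin t = r * sin t" for t
    using assms(1) unfolding lifts_matrix_def by auto
  have c: "c = 0" "a > 0" using *[of 0] by auto
  have b: "b = 0" using *[of "pi/2"] by auto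
  have "a = d" using *[of "pi/4"] b c by (auto simp: cos_45 sin_45)
  then show ?thesis using assms(2) b c by (auto simp: power2_eq_1_iff power2_eq_square[symmetric])
qed

text \<open>For a matrix without negative eigenvalues no vector is turned by \<open>\<pi>\<close>, so the principal argument
  gives a continuous lift.\<close>
definition small_lift :: "real \<Rightarrow> real \<Rightarrow> real \<Rightarrow> real \<Rightarrow> real \<Rightarrow> real" where
  "small_lift a b c d t = t + Arg (Complex ((a * cos t + b * sin t) * cos t + (c * cos t + d * sin t) * sin t)
                                    ((c * cos t + d * sin t) * cos t - (a * cos t + b * sin t) * sin t))"

lemma small_lift:
  assumes "\<And>t. (c * cos t + d * sin t) * cos t - (a * cos t + b * sin t) * sin t = 0 \<Longrightarrow>
     (a * cos t + b * sin t) * cos t + (c * cos t + d * sin t) * sin t > 0"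
  shows "lifts_matrix a b c d (small_lift a b c d)" "\<bar>small_lift a b c d t - t\<bar> < pi"
proof -
  define X Y where "X = (\<lambda>t. a * cos t + b * sin t)" and "Y = (\<lambda>t. c * cos t + d * sin t)"
  \<comment> \<open>\<open>Z t\<close> is \<open>X t + i * Y t\<close> multiplied by exp(-i t), so
    its argument is the angle through which the matrix turns the unit vector at
    \<open>t\<close>.\<close>
  define Z where "Z = (\<lambda>t. Complex (X t * cos t + Y t * sin t) (Y t * cos t - X t * sin t))"
  have pos: "Y t * cos t - X t * sin t = 0 \<Longrightarrow> X t * cos t + Y t * sin t > 0" for t
    using assms by (auto simp: X_def Y_def)
  have Z: "Z t \<notin> \<real>\<^sub>\<le>\<^sub>0" for t
    using pos[of t] by (auto simp: Z_def complex_nonpos_Reals_iff)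
  have sl: "small_lift a b c d = (\<lambda>t. t + Arg (Z t))"
    by (rule ext) (simp add: small_lift_def Z_def X_def Y_def)
  show "\<bar>small_lift a b c d t - t\<bar> < pi"
    using mpi_less_Arg[of "Z t"] Arg_le_pi[of "Z t"] Arg_eq_pi[of "Z t"] pos[of t]
    by (auto simp: sl Z_def)
  show "lifts_matrix a b c d (small_lift a b c d)"
    unfolding lifts_matrix_def sl
  proof (intro conjI allI)
    show "continuous_on UNIV (\<lambda>t. t + Arg (Z t))"
      using Z by (intro continuous_intros) (auto simp: Z_def X_def Y_def Complex_eq intro!: continuous_intros)
    fix t
    have nz: "Z t \<noteq> 0" using Z[of t] by auto
    define r where "r = norm (Z t)"
    have "Z t = rcis r (Arg (Z t))" using Arg_eq[OF nz] by (simp add: r_def rcis_def cis_conv_exp)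
    then have R: "Re (Z t) = r * cos (Arg (Z t))" and I: "Im (Z t) = r * sin (Arg (Z t))"
      by (metis Re_rcis, metis Im_rcis)
    have sq: "(sin t)\<^sup>2 = 1 - (cos t)\<^sup>2" by (simp add: sin_squared_eq)
    have "X t = Re (Z t) * cos t - Im (Z t) * sin t" "Y t = Im (Z t) * cos t + Re (Z t) * sin t"
      using sq unfolding Z_def complex.sel by algebra+
    then have "X t = r * cos (t + Arg (Z t))" "Y t = r * sin (t + Arg (Z t))"
      unfolding R I by (simp_all add: cos_add sin_add algebra_simps)
    then show "\<exists>r>0. a * cos t + b * sin t = r * cos (t + Arg (Z t)) \<and> c * cos t + d * sin t = r * sin (t + Arg (Z t))"
      using nz by (intro exI[of _ r]) (auto simp: X_def Y_def r_def)
  qed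
qed

text \<open>A unipotent matrix sends a vector to a multiple of itself only if it fixes it, so the
  principal argument never meets its branch cut.\<close>

lemma small_lift_unipotent:
  shows upper_lift: "lifts_matrix 1 x 0 1 (small_lift 1 x 0 1)"
    and upper_lift_near: "\<bar>small_lift 1 x 0 1 t - t\<bar> < pi"
    and lower_lift: "lifts_matrix 1 0 y 1 (small_lift 1 0 y 1)"
    and lower_lift_near: "\<bar>small_lift 1 0 y 1 t - t\<bar> < pi"
proof -
  have *: "(cos t + x * sin t) * cos t + sin t * sin t = 1 + x * sin t * cos t"
    "sin t * cos t - (cos t + x * sin t) * sin t = - x * (sin t)\<^sup>2" for t x :: real
    using sin_cos_squared_add[of t] by (simp_all add: power2_eq_square algebra_simps)
  have 1: "(0 * cos t + 1 * sin t) * cos t - (1 * cos t + x * sin t) * sin t = 0 \<Longrightarrow>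
     (1 * cos t + x * sin t) * cos t + (0 * cos t + 1 * sin t) * sin t > 0" for t
    using * by auto
  show "lifts_matrix 1 x 0 1 (small_lift 1 x 0 1)" "\<bar>small_lift 1 x 0 1 t - t\<bar> < pi"
    by (rule small_lift, rule 1, assumption)+
  have *: "cos t * cos t + (y * cos t + sin t) * sin t = 1 + y * sin t * cos t"
    "(y * cos t + sin t) * cos t - cos t * sin t = y * (cos t)\<^sup>2" for t
    using sin_cos_squared_add[of t] by (simp_all add: power2_eq_square algebra_simps)
  have 1: "(y * cos t + 1 * sin t) * cos t - (1 * cos t + 0 * sin t) * sin t = 0 \<Longrightarrow>
     (1 * cos t + 0 * sin t) * cos t + (y * cos t + 1 * sin t) * sin t > 0" for t
    using * by auto
  show "lifts_matrix 1 0 y 1 (small_lift 1 0 y 1)" "\<bar>small_lift 1 0 y 1 t - t\<bar> < pi"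
    by (rule small_lift, rule 1, assumption)+
qed

lemma upper_lift_0: "small_lift 1 x 0 1 0 = 0" and lower_lift_pi_half: "small_lift 1 0 y 1 (pi/2) = pi/2"
  by (simp_all add: small_lift_def one_complex.code[symmetric])

lemma upper_lift_comp: "small_lift 1 x 0 1 \<circ> small_lift 1 y 0 1 = small_lift 1 (x + y) 0 1"
  using lifts_matrix_comp[OF upper_lift[of x] upper_lift[of y]] upper_lift[of "x + y"]
  by (intro lifts_matrix_eqI[where t=0]) (auto simp: upper_lift_0 add.commute)

lemma lower_lift_comp: "small_lift 1 0 x 1 \<circ> small_lift 1 0 y 1 = small_lift 1 0 (x + y) 1"
  using lifts_matrix_comp[OF lower_lift[of x] lower_lift[of y]] lower_lift[of "x + y"]
  by (intro lifts_matrix_eqI[where t="pi/2"]) (auto simp: lower_lift_pi_half)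

lemma lifts_rotation: "lifts_matrix 0 1 (-1) 0 (\<lambda>t. t - pi/2)"
  unfolding lifts_matrix_def by (auto intro!: exI[of _ 1] continuous_intros simp: cos_diff sin_diff)

lemma lower_lift_0: "x > 0 \<Longrightarrow> small_lift 1 0 (-x) 1 0 = - arctan x"
proof (rule lifts_matrix_value_eq[OF lower_lift])
  show "0 < sqrt (1 + x\<^sup>2)" by (simp add: add_pos_nonneg)
  show "1 * cos 0 + 0 * sin 0 = sqrt (1 + x\<^sup>2) * cos (- arctan x)"
    "- x * cos 0 + 1 * sin 0 = sqrt (1 + x\<^sup>2) * sin (- arctan x)"
    using \<open>0 < sqrt (1 + x\<^sup>2)\<close> by (auto simp: cos_arctan sin_arctan)
  show "\<bar>small_lift 1 0 (- x) 1 0 - - arctan x\<bar> < 2 * pi"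
    using lower_lift_near[of "-x" 0] arctan_bounded[of x] by linarith
qed

text \<open>Both words lift the same matrix, and at the angle 0 both end at -pi/2: the left one runs
  through 0, 0, -arctan y, -pi/2 and the right one through 0, -arctan y, -pi/2, -pi/2.\<close>

lemma braid_lifts:
  assumes "x * y = 1" "x > 0"
  shows "small_lift 1 x 0 1 \<circ> small_lift 1 0 (-y) 1 \<circ> small_lift 1 x 0 1 =
         small_lift 1 0 (-y) 1 \<circ> small_lift 1 x 0 1 \<circ> small_lift 1 0 (-y) 1"
    (is "?u \<circ> ?l \<circ> ?u = ?l \<circ> ?u \<circ> ?l")
proof -
  have y: "y > 0" using assms by (metis zero_less_mult_pos zero_less_one)
  have l0: "?l 0 = - arctan y" using lower_lift_0[OF y] .
  have sq: "0 < sqrt (1 + y\<^sup>2)" by (simp add: add_pos_nonneg)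
  have u: "?u (- arctan y) = - (pi/2)"
  proof (rule lifts_matrix_value_eq[OF upper_lift])
    show "0 < sin (arctan y)" using y sq by (simp add: sin_arctan)
    show "1 * cos (- arctan y) + x * sin (- arctan y) = sin (arctan y) * cos (- (pi/2))"
      "0 * cos (- arctan y) + 1 * sin (- arctan y) = sin (arctan y) * sin (- (pi/2))"
      using sq assms by (auto simp: cos_arctan sin_arctan)
    show "\<bar>?u (- arctan y) - - (pi/2)\<bar> < 2 * pi"
      using upper_lift_near[of x "- arctan y"] arctan_bounded[of y] by linarith
  qed
  have l: "?l (- (pi/2)) = - (pi/2)"
  proof (rule lifts_matrix_value_eq[OF lower_lift, of 1])
    show "\<bar>?l (- (pi/2)) - - (pi/2)\<bar> < 2 * pi"
      using lower_lift_near[of "-y" "-(pi/2)"] pi_gt_zero by linarith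
  qed auto
  note U = lifts_matrix_comp[OF lifts_matrix_comp[OF upper_lift[of x] lower_lift[of "-y"]] upper_lift[of x]]
  note L = lifts_matrix_comp[OF lifts_matrix_comp[OF lower_lift[of "-y"] upper_lift[of x]] lower_lift[of "-y"]]
  show ?thesis
  proof (rule lifts_matrix_eqI[where t=0])
    show "lifts_matrix 0 x (-y) 0 (?u \<circ> ?l \<circ> ?u)" using U assms by (simp add: mult.commute)
    show "lifts_matrix 0 x (-y) 0 (?l \<circ> ?u \<circ> ?l)" using L assms by (simp add: mult.commute)
    show "(?u \<circ> ?l \<circ> ?u) 0 = (?l \<circ> ?u \<circ> ?l) 0" by (simp add: upper_lift_0 l0 u l)
  qed
qed

text \<open>The fourth power of this word is the translation by -2 pi, which brings the kernel of
  the covering into the generated subgroup. Its square later identifies \<open>t\<close> as the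
  translation by -pi.\<close>

lemma braid_lift_1:
  "small_lift 1 1 0 1 \<circ> small_lift 1 0 (-1) 1 \<circ> small_lift 1 1 0 1 = (\<lambda>t. t - pi/2)"  (is "?u \<circ> ?l \<circ> ?u = _")
proof (rule lifts_matrix_eqI[where t=0])
  show "lifts_matrix 0 1 (-1) 0 (?u \<circ> ?l \<circ> ?u)"
    using lifts_matrix_comp[OF lifts_matrix_comp[OF upper_lift[of 1] lower_lift[of "-1"]] upper_lift[of 1]] by simp
  show "lifts_matrix 0 1 (-1) 0 (\<lambda>t. t - pi/2)" by (fact lifts_rotation)
  have "?u (- (pi/4)) = - (pi/2)"
  proof (rule lifts_matrix_value_eq[OF upper_lift])
    show "0 < sqrt 2 / 2" by simp
    show "\<bar>?u (- (pi/4)) - - (pi/2)\<bar> < 2 * pi"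
      using upper_lift_near[of 1 "- (pi/4)"] pi_gt_zero by linarith
  qed (auto simp: cos_45 sin_45)
  then show "(?u \<circ> ?l \<circ> ?u) 0 = 0 - pi/2"
    using lower_lift_0[of 1] by (simp add: upper_lift_0 arctan_one)
qed

section \<open>Generation by two elements\<close>

lemma dyadic_of_int: "real_of_int m \<in> dyadic"
  unfolding dyadic_def by (auto intro!: exI[of _ m] exI[of _ "0::nat"])

lemma dyadic_mult: "x \<in> dyadic \<Longrightarrow> y \<in> dyadic \<Longrightarrow> x * y \<in> dyadic"
proof -
  assume "x \<in> dyadic" "y \<in> dyadic"
  then obtain m k n l where "x = real_of_int m / 2 ^ k" "y = real_of_int n / 2 ^ l" unfolding dyadic_def by blast
  then have "x * y = real_of_int (m * n) / 2 ^ (k + l)" by (simp add: power_add)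
  then show ?thesis unfolding dyadic_def by blast
qed

lemma dyadic_add: "x \<in> dyadic \<Longrightarrow> y \<in> dyadic \<Longrightarrow> x + y \<in> dyadic"
proof -
  assume "x \<in> dyadic" "y \<in> dyadic"
  then obtain m k n l where "x = real_of_int m / 2 ^ k" "y = real_of_int n / 2 ^ l" unfolding dyadic_def by blast
  then have "x + y = real_of_int (m * 2 ^ l + n * 2 ^ k) / 2 ^ (k + l)"
    by (simp add: power_add add_divide_distrib)
  then show ?thesis unfolding dyadic_def by blast
qed

lemma dyadic_uminus: "x \<in> dyadic \<Longrightarrow> - x \<in> dyadic"
  using dyadic_mult[OF dyadic_of_int[of "-1"]] by simp

lemma dyadic_diff: "x \<in> dyadic \<Longrightarrow> y \<in> dyadic \<Longrightarrow> x - y \<in> dyadic"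
  using dyadic_add[OF _ dyadic_uminus] by simp

lemma dyadic_half_power: "1 / 2 ^ k \<in> dyadic"
  unfolding dyadic_def by (auto intro!: exI[of _ "1::int"])

lemma dyadic_0_1: "0 \<in> dyadic" "1 \<in> dyadic" "-1 \<in> dyadic" "1/2 \<in> dyadic"
  using dyadic_of_int[of 0] dyadic_of_int[of 1] dyadic_of_int[of "-1"] dyadic_half_power[of 1] by simp_all

lemmas dyadic_closed = dyadic_mult dyadic_add dyadic_uminus dyadic_diff dyadic_0_1 dyadic_of_int

lemma Gamma_tilde_iff: "f \<in> carrier Gamma_tilde \<longleftrightarrow> (\<exists>a b c d. a \<in> dyadic \<and> b \<in> dyadic \<and> c \<in> dyadic \<and> d \<in> dyadic
                         \<and> a * d - b * c = 1 \<and> lifts_matrix a b c d f)"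
  by (simp add: Gamma_tilde_def)

lemma Gamma_tildeI:
  "\<lbrakk>lifts_matrix a b c d f; a * d - b * c = 1; a \<in> dyadic; b \<in> dyadic; c \<in> dyadic; d \<in> dyadic\<rbrakk>
    \<Longrightarrow> f \<in> carrier Gamma_tilde"
  unfolding Gamma_tilde_iff by blast

lemma Gamma_tilde_mult [simp]: "f \<otimes>\<^bsub>Gamma_tilde\<^esub> g = f \<circ> g"
  and Gamma_tilde_one [simp]: "\<one>\<^bsub>Gamma_tilde\<^esub> = id"
  by (simp_all add: Gamma_tilde_def)

lemma group_Gamma_tilde: "group Gamma_tilde"
proof (rule groupI)
  fix f g assume f: "f \<in> carrier Gamma_tilde" and g: "g \<in> carrier Gamma_tilde"
  obtain a b c d where A: "a \<in> dyadic" "b \<in> dyadic" "c \<in> dyadic" "d \<in> dyadic"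
    "a * d - b * c = 1" "lifts_matrix a b c d f" using f by (auto simp: Gamma_tilde_iff)
  obtain a' b' c' d' where B: "a' \<in> dyadic" "b' \<in> dyadic" "c' \<in> dyadic" "d' \<in> dyadic"
    "a' * d' - b' * c' = 1" "lifts_matrix a' b' c' d' g" using g by (auto simp: Gamma_tilde_iff)
  have "(a*a'+b*c') * (c*b'+d*d') - (a*b'+b*d') * (c*a'+d*c') = (a * d - b * c) * (a' * d' - b' * c')"
    by algebra
  then have "(a*a'+b*c') * (c*b'+d*d') - (a*b'+b*d') * (c*a'+d*c') = 1"
    unfolding A B by simp
  then show "f \<otimes>\<^bsub>Gamma_tilde\<^esub> g \<in> carrier Gamma_tilde"
    unfolding Gamma_tilde_mult
    by (rule Gamma_tildeI[OF lifts_matrix_comp[OF A(6) B(6)]]) (intro dyadic_add dyadic_mult A B)+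
next
  show "\<one>\<^bsub>Gamma_tilde\<^esub> \<in> carrier Gamma_tilde"
    unfolding Gamma_tilde_one by (rule Gamma_tildeI[OF lifts_matrix_id]) (simp_all add: dyadic_0_1)
next
  fix f assume f: "f \<in> carrier Gamma_tilde"
  then obtain a b c d where A: "a \<in> dyadic" "b \<in> dyadic" "c \<in> dyadic" "d \<in> dyadic"
    "a * d - b * c = 1" "lifts_matrix a b c d f" by (auto simp: Gamma_tilde_iff)
  have det: "d * a - (- b) * (- c) = 1" using A(5) by (simp add: algebra_simps)
  then obtain g where g: "lifts_matrix d (-b) (-c) a g" using lifts_matrix_exists by blast
  \<comment> \<open>An arbitrary lift of the inverse matrix inverts \<open>f\<close> only up to a
    translation by 2 pi k, which is then undone in \<open>h\<close>.\<close>
  have "lifts_matrix 1 0 0 1 (g \<circ> f)"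
    using lifts_matrix_comp[OF g A(6)] A(5) by (simp add: algebra_simps)
  then obtain k :: int where k: "\<And>t. (g \<circ> f) t = id t + 2 * pi * k"
    using lifts_matrix_unique[OF _ lifts_matrix_id] by metis
  define h where "h = (\<lambda>t. g t + 2 * pi * real_of_int (-k))"
  have "lifts_matrix d (-b) (-c) a h" unfolding h_def by (rule lifts_matrix_shift[OF g])
  then have "h \<in> carrier Gamma_tilde"
    using A(1-4) det by (intro Gamma_tildeI[of d "-b" "-c" a]) (simp_all add: dyadic_uminus)
  moreover have "h \<circ> f = id" using k by (auto simp: h_def fun_eq_iff)
  ultimately show "\<exists>h\<in>carrier Gamma_tilde. h \<otimes>\<^bsub>Gamma_tilde\<^esub> f = \<one>\<^bsub>Gamma_tilde\<^esub>" by auto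
qed (auto simp: comp_assoc)

interpretation GT: group Gamma_tilde by (rule group_Gamma_tilde)

section \<open>The two generators and the matrices that they reach\<close>

definition gen_p :: "real \<Rightarrow> real" where "gen_p = small_lift 1 (1/2) 0 1"
definition gen_q :: "real \<Rightarrow> real" where "gen_q = small_lift 1 0 (-1) 1"

lemma lifts_gen_p: "lifts_matrix 1 (1/2) 0 1 gen_p" and lifts_gen_q: "lifts_matrix 1 0 (-1) 1 gen_q"
  by (simp_all only: gen_p_def gen_q_def upper_lift lower_lift)

lemma gens_carrier: "gen_p \<in> carrier Gamma_tilde" "gen_q \<in> carrier Gamma_tilde"
  by (rule Gamma_tildeI[OF lifts_gen_p] Gamma_tildeI[OF lifts_gen_q]; simp add: dyadic_0_1)+

lemma upper_lift_id: "small_lift 1 0 0 1 = id"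
  using upper_lift[of 0] lifts_matrix_id by (rule lifts_matrix_eqI[where t=0]) (simp add: upper_lift_0)

lemma gen_p_gen_p: "gen_p \<circ> gen_p = small_lift 1 1 0 1"
  unfolding gen_p_def upper_lift_comp by simp

lemma gen_q_gen_q: "gen_q \<circ> gen_q = small_lift 1 0 (-2) 1"
  unfolding gen_q_def lower_lift_comp by simp

lemma gens_relation_1: "gen_p \<circ> gen_p \<circ> gen_q \<circ> gen_p \<circ> gen_p = gen_q \<circ> gen_p \<circ> gen_p \<circ> gen_q"
  using braid_lifts[of 1 1] unfolding gen_p_gen_p[symmetric] gen_q_def[symmetric] by (simp add: comp_assoc)

lemma gens_relation_2: "gen_p \<circ> gen_q \<circ> gen_q \<circ> gen_p = gen_q \<circ> gen_q \<circ> gen_p \<circ> gen_q \<circ> gen_q"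
  using braid_lifts[of "1/2" 2] unfolding gen_p_def[symmetric] gen_q_gen_q[symmetric] by (simp add: comp_assoc)

lemma gens_rotation: "gen_p \<circ> gen_p \<circ> gen_q \<circ> gen_p \<circ> gen_p = (\<lambda>t. t - pi/2)"
  using braid_lift_1 unfolding gen_p_gen_p[symmetric] gen_q_def[symmetric] by (simp add: comp_assoc)

lemma inv_gens: "inv\<^bsub>Gamma_tilde\<^esub> gen_p = small_lift 1 (-1/2) 0 1" "inv\<^bsub>Gamma_tilde\<^esub> gen_q = small_lift 1 0 1 1"
proof -
  have "small_lift 1 (-1/2) 0 1 \<in> carrier Gamma_tilde"
    using dyadic_uminus[of "1/2"] by (intro Gamma_tildeI[OF upper_lift]) (simp_all add: dyadic_0_1)
  then show "inv\<^bsub>Gamma_tilde\<^esub> gen_p = small_lift 1 (-1/2) 0 1"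
    by (intro GT.inv_equality gens_carrier) (simp_all add: gen_p_def upper_lift_comp upper_lift_id)
  have "small_lift 1 0 1 1 \<in> carrier Gamma_tilde"
    by (rule Gamma_tildeI[OF lower_lift]) (simp_all add: dyadic_0_1)
  then show "inv\<^bsub>Gamma_tilde\<^esub> gen_q = small_lift 1 0 1 1"
    by (intro GT.inv_equality gens_carrier) (simp_all add: gen_q_def lower_lift_comp upper_lift_id)
qed

text \<open>The choice of the lift is deliberately forgotten, which turns generation into a question
  about matrices. The lost translations are restored by \<open>generate_translation\<close>.\<close>

definition covered :: "real \<Rightarrow> real \<Rightarrow> real \<Rightarrow> real \<Rightarrow> bool" where
  "covered a b c d \<longleftrightarrow> (\<exists>f\<in>generate Gamma_tilde {gen_p, gen_q}. lifts_matrix a b c d f)"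

lemma covered_mult:
  assumes "covered a b c d" "covered a' b' c' d'"
    and "x = a*a'+b*c'" "y = a*b'+b*d'" "z = c*a'+d*c'" "w = c*b'+d*d'"
  shows "covered x y z w"
proof -
  obtain f g where f: "f \<in> generate Gamma_tilde {gen_p, gen_q}" "lifts_matrix a b c d f"
    and g: "g \<in> generate Gamma_tilde {gen_p, gen_q}" "lifts_matrix a' b' c' d' g"
    using assms(1,2) unfolding covered_def by blast
  show ?thesis
    unfolding covered_def assms(3-6)
    using generate.eng[OF f(1) g(1)] lifts_matrix_comp[OF f(2) g(2)] by auto
qed

lemma covered_one: "covered 1 0 0 1"
  using generate.one[of Gamma_tilde "{gen_p, gen_q}"] lifts_matrix_id by (auto simp: covered_def)

lemma covered_gens:
  "covered 1 (1/2) 0 1" "covered 1 (-1/2) 0 1" "covered 1 0 (-1) 1" "covered 1 0 1 1"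
proof -
  have "inv\<^bsub>Gamma_tilde\<^esub> gen_p \<in> generate Gamma_tilde {gen_p, gen_q}" "inv\<^bsub>Gamma_tilde\<^esub> gen_q \<in> generate Gamma_tilde {gen_p, gen_q}"
    "gen_p \<in> generate Gamma_tilde {gen_p, gen_q}" "gen_q \<in> generate Gamma_tilde {gen_p, gen_q}"
    by (auto intro: generate.intros)
  then show "covered 1 (1/2) 0 1" "covered 1 (-1/2) 0 1" "covered 1 0 (-1) 1" "covered 1 0 1 1"
    using lifts_gen_p lifts_gen_q upper_lift[of "-1/2"] lower_lift[of 1] unfolding covered_def inv_gens by blast+
qed

lemma covered_weyl: "covered 0 1 (-1) 0" "covered 0 (-1) 1 0"
proof -
  have 1: "covered 1 1 0 1" "covered 1 (-1) 0 1"
    using covered_mult[OF covered_gens(1) covered_gens(1)] covered_mult[OF covered_gens(2) covered_gens(2)] by simp_all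
  have 2: "covered 0 1 (-1) 1" "covered 0 (-1) 1 1"
    using covered_mult[OF 1(1) covered_gens(3)] covered_mult[OF 1(2) covered_gens(4)] by simp_all
  show "covered 0 1 (-1) 0" "covered 0 (-1) 1 0"
    using covered_mult[OF 2(1) 1(1)] covered_mult[OF 2(2) 1(2)] by simp_all
qed

lemma covered_upper_half_int: "covered 1 (real_of_int n / 2) 0 1"
proof (induction n rule: int_induct[where k=0])
  case base show ?case using covered_one by simp
next
  case (step1 i) show ?case
    by (rule covered_mult[OF covered_gens(1) step1(2)]) (simp_all add: field_simps)
next
  case (step2 i) show ?case
    by (rule covered_mult[OF covered_gens(2) step2(2)]) (simp_all add: field_simps)
qed

lemma covered_upper_imp_lower: "covered 1 (-x) 0 1 \<Longrightarrow> covered 1 0 x 1"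
  by (rule covered_mult[OF covered_weyl(2) covered_mult[OF _ covered_weyl(1)]]) auto

text \<open>The usual factorisation of a torus element: with w(a) the product of the upper unipotent
  a, the lower unipotent -1/a and the upper unipotent a, diag(2, 1/2) is w(2) times the inverse of
  w(1).\<close>

lemma covered_torus_2: "covered 2 0 0 (1/2)" "covered (1/2) 0 0 2"
proof -
  have X: "covered 1 2 0 1" "covered 1 (-2) 0 1"
    using covered_upper_half_int[of 4] covered_upper_half_int[of "-4"] by simp_all
  have Y: "covered 1 0 (-1/2) 1" "covered 1 0 (1/2) 1"
    using covered_upper_imp_lower[of "-1/2"] covered_upper_imp_lower[of "1/2"] covered_gens by simp_all
  have 1: "covered 0 2 (-1/2) 1" "covered 0 (-2) (1/2) 1"
    using covered_mult[OF X(1) Y(1)] covered_mult[OF X(2) Y(2)] by simp_all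
  have 2: "covered 0 2 (-1/2) 0" "covered 0 (-2) (1/2) 0"
    using covered_mult[OF 1(1) X(1)] covered_mult[OF 1(2) X(2)] by simp_all
  show "covered 2 0 0 (1/2)" using covered_mult[OF 2(1) covered_weyl(2)] by simp
  show "covered (1/2) 0 0 2" using covered_mult[OF covered_weyl(1) 2(2)] by simp
qed

text \<open>Conjugation by diag(1/2, 2) divides the entry of an upper unipotent by 4. Denominators
  are therefore first written as powers of 4.\<close>

lemma covered_upper: "x \<in> dyadic \<Longrightarrow> covered 1 x 0 1"
proof -
  have *: "covered 1 (real_of_int n / 4 ^ k) 0 1" for n k
  proof (induction k)
    case 0 show ?case using covered_upper_half_int[of "2 * n"] by simp
  next
    case (Suc k) show ?case
      by (rule covered_mult[OF covered_torus_2(2) covered_mult[OF Suc covered_torus_2(1) HOL.refl HOL.refl HOL.refl HOL.refl]]) auto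
  qed
  assume "x \<in> dyadic"
  then obtain n k where "x = real_of_int n / 2 ^ k" unfolding dyadic_def by blast
  moreover have "(4::real) ^ k = 2 ^ k * 2 ^ k" by (simp flip: power_mult_distrib)
  ultimately have "x = real_of_int (n * 2 ^ k) / 4 ^ k" by simp
  with * show ?thesis by metis
qed

lemma covered_lower: "x \<in> dyadic \<Longrightarrow> covered 1 0 x 1"
  by (rule covered_upper_imp_lower) (rule covered_upper, rule dyadic_uminus)

lemma covered_torus: "covered (2 ^ r / 2 ^ k) 0 0 (2 ^ k / 2 ^ r)"
proof -
  have 1: "covered (2 ^ r) 0 0 (1 / 2 ^ r)" for r
  proof (induction r)
    case 0 show ?case using covered_one by simp
  next
    case (Suc r) show ?case using covered_mult[OF covered_torus_2(1) Suc] by simp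
  qed
  have 2: "covered (1 / 2 ^ r) 0 0 (2 ^ r)" for r
  proof (induction r)
    case 0 show ?case using covered_one by simp
  next
    case (Suc r) show ?case using covered_mult[OF covered_torus_2(2) Suc] by simp
  qed
  show ?thesis using covered_mult[OF 1[of r] 2[of k]] by simp
qed

lemma covered_neg: "covered a b c d \<Longrightarrow> covered (-a) (-b) (-c) (-d)"
  using covered_mult[OF covered_mult[OF covered_weyl(1) covered_weyl(1)], of "-1" 0 0 "-1" a b c d "-a" "-b" "-c" "-d"]
  by simp

text \<open>The diagonal entries are units of Z[1/2]. Their numerators divide a power of 2, so they
  are powers of 2 up to sign, and a torus element and an upper unipotent finish the
  factorisation.\<close>

lemma covered_triangular:
  assumes "a \<in> dyadic" "b \<in> dyadic" "d \<in> dyadic" "a * d = 1"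
  shows "covered a b 0 d"
proof -
  obtain m k n l where md: "a = real_of_int m / 2 ^ k" "d = real_of_int n / 2 ^ l"
    using assms unfolding dyadic_def by blast
  have "real_of_int (m * n) = real_of_int (2 ^ (k + l))"
    using assms(4) md by (simp add: power_add field_simps)
  then have "m * n = 2 ^ (k + l)" by linarith
  then have "nat \<bar>m\<bar> * nat \<bar>n\<bar> = 2 ^ (k + l)"
    by (simp add: abs_mult[symmetric] nat_mult_distrib[symmetric] nat_power_eq)
  then obtain r where "nat \<bar>m\<bar> = 2 ^ r"
    by (metis divides_primepow_nat dvd_triv_left two_is_prime_nat)
  then have "\<bar>m\<bar> = 2 ^ r" by (metis abs_ge_zero nat_eq_numeral_power_cancel_iff)
  then consider "m = 2 ^ r" | "m = - (2 ^ r)" by linarith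
  moreover have d: "d = 1 / a" using assms(4) by (auto simp: eq_divide_eq mult.commute)
  ultimately have "covered a 0 0 d"
  proof cases
    case 1
    then have "a = 2 ^ r / 2 ^ k" "d = 2 ^ k / 2 ^ r" using md(1) d by auto
    then show ?thesis using covered_torus by simp
  next
    case 2
    then have "a = - (2 ^ r / 2 ^ k)" "d = - (2 ^ k / 2 ^ r)" using md(1) d by auto
    then show ?thesis using covered_neg[OF covered_torus[of r k]] by simp
  qed
  moreover have "covered 1 (b * d) 0 1" using assms by (intro covered_upper dyadic_closed)
  ultimately show ?thesis by (rule covered_mult) (use assms(4) in auto)
qed

text \<open>Euclid's algorithm on the numerators of the first column, carried out by left
  multiplication with unipotents, ends at a triangular matrix.\<close>

lemma covered_SL2:
  assumes "a = real_of_int m / 2 ^ k" "c = real_of_int n / 2 ^ l" "b \<in> dyadic" "d \<in> dyadic" "a * d - b * c = 1"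
  shows "covered a b c d"
  using assms
proof (induction "nat (\<bar>m\<bar> + \<bar>n\<bar>)" arbitrary: a b c d m n rule: less_induct)
  case less
  have ac: "a \<in> dyadic" "c \<in> dyadic" using less.prems(1,2) unfolding dyadic_def by blast+
  \<comment> \<open>The product of the signs turns the subtraction into one of absolute values, so a
    Euclidean step strictly decreases the larger numerator.\<close>
  have abs_less: "\<bar>x - sgn x * sgn y * y\<bar> < \<bar>x\<bar>" if "y \<noteq> 0" "\<bar>y\<bar> \<le> \<bar>x\<bar>" for x y :: int
    using that by (auto simp: sgn_if abs_if split: if_splits)
  consider "n = 0" | "m = 0" "n \<noteq> 0" | "m \<noteq> 0" "n \<noteq> 0" "\<bar>n\<bar> \<le> \<bar>m\<bar>" | "m \<noteq> 0" "n \<noteq> 0" "\<bar>m\<bar> \<le> \<bar>n\<bar>"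
    by linarith
  then show ?case
  proof cases
    case 1
    then show ?thesis using covered_triangular[of a b d] ac less.prems by simp
  next
    case 2
    then have "covered c d 0 (-b)" using covered_triangular[of c d "-b"] ac less.prems dyadic_uminus
      by (simp add: mult.commute)
    then show ?thesis using 2 less.prems(1) by (auto intro: covered_mult[OF covered_weyl(2)])
  next
    case 3
    define s where "s = sgn m * sgn n"
    \<comment> \<open>The factor 2^l / 2^k brings \<open>c\<close> to the denominator of
      \<open>a\<close>, so that subtracting \<open>x * c\<close> acts on numerators as
      \<open>m - s * n\<close>.\<close>
    define x where "x = real_of_int s * 2 ^ l / 2 ^ k"
    have x: "x \<in> dyadic" unfolding x_def dyadic_def by (auto intro!: exI[of _ "s * 2 ^ l"])
    have "covered (a - x * c) (b - x * d) c d"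
    proof (rule less.hyps[OF _ _ less.prems(2)])
      show "nat (\<bar>m - s * n\<bar> + \<bar>n\<bar>) < nat (\<bar>m\<bar> + \<bar>n\<bar>)" using abs_less[of n m] 3 by (simp add: s_def)
      show "a - x * c = real_of_int (m - s * n) / 2 ^ k" by (simp add: less.prems x_def field_simps)
      show "b - x * d \<in> dyadic" "d \<in> dyadic" using x ac less.prems by (auto intro: dyadic_closed)
      show "(a - x * c) * d - (b - x * d) * c = 1" using less.prems(5) by (simp add: algebra_simps)
    qed
    then show ?thesis by (rule covered_mult[OF covered_upper[OF x]]) auto
  next
    case 4
    define s where "s = sgn n * sgn m"
    define x where "x = real_of_int s * 2 ^ k / 2 ^ l"
    have x: "x \<in> dyadic" unfolding x_def dyadic_def by (auto intro!: exI[of _ "s * 2 ^ k"])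
    have "covered a b (c - x * a) (d - x * b)"
    proof (rule less.hyps[OF _ less.prems(1)])
      show "nat (\<bar>m\<bar> + \<bar>n - s * m\<bar>) < nat (\<bar>m\<bar> + \<bar>n\<bar>)" using abs_less[of m n] 4 by (simp add: s_def)
      show "c - x * a = real_of_int (n - s * m) / 2 ^ l" by (simp add: less.prems x_def field_simps)
      show "d - x * b \<in> dyadic" "b \<in> dyadic" using x ac less.prems by (auto intro: dyadic_closed)
      show "a * (d - x * b) - b * (c - x * a) = 1" using less.prems(5) by (simp add: algebra_simps)
    qed
    then show ?thesis by (rule covered_mult[OF covered_lower[OF x]]) auto
  qed
qed

lemma generate_translation: "(\<lambda>t. t + 2 * pi * real_of_int k) \<in> generate Gamma_tilde {gen_p, gen_q}"
proof -
  let ?K = "generate Gamma_tilde {gen_p, gen_q}"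
  have cl: "f \<circ> g \<in> ?K" if "f \<in> ?K" "g \<in> ?K" for f g
    using generate.eng[OF that] by simp
  have "gen_p \<in> ?K" "gen_q \<in> ?K" by (auto intro: generate.intros)
  then have "gen_p \<circ> gen_p \<circ> gen_q \<circ> gen_p \<circ> gen_p \<in> ?K" by (intro cl)
  then have r: "(\<lambda>t. t - pi/2) \<in> ?K" by (simp only: gens_rotation)
  define T where "T = (\<lambda>k::int. \<lambda>t::real. t + 2 * pi * real_of_int k)"
  have rr: "(\<lambda>t. t - pi/2) \<circ> (\<lambda>t. t - pi/2) \<circ> ((\<lambda>t. t - pi/2) \<circ> (\<lambda>t. t - pi/2)) = T (-1)"
    by (auto simp: T_def fun_eq_iff)
  have 1: "T (-1) \<in> ?K" unfolding rr[symmetric] by (intro cl r)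
  have TT: "T k \<circ> T l = T (k + l)" for k l by (auto simp: T_def fun_eq_iff algebra_simps)
  have T0: "T 0 = id" by (auto simp: T_def)
  have Tc: "T k \<in> carrier Gamma_tilde" for k
    using lifts_matrix_shift[OF lifts_matrix_id, of k]
    by (intro Gamma_tildeI[of 1 0 0 1]) (simp_all add: T_def dyadic_0_1)
  have "inv\<^bsub>Gamma_tilde\<^esub> (T (-1)) = T 1" by (rule GT.inv_equality) (simp_all add: TT T0 Tc)
  then have 2: "T 1 \<in> ?K"
    using GT.generate_m_inv_closed[OF _ 1] gens_carrier by auto
  have "T k \<in> ?K"
  proof (induction k rule: int_induct[where k=0])
    case base show ?case unfolding T0 using generate.one[of Gamma_tilde "{gen_p, gen_q}"] unfolding Gamma_tilde_one .
  next
    case (step1 i) then show ?case using cl[OF step1(2) 2] by (simp add: TT)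
  next
    case (step2 i) then show ?case using cl[OF step2(2) 1] by (simp add: TT)
  qed
  then show ?thesis by (simp add: T_def)
qed

lemma generate_Gamma_tilde: "generate Gamma_tilde {gen_p, gen_q} = carrier Gamma_tilde"
proof
  show "generate Gamma_tilde {gen_p, gen_q} \<subseteq> carrier Gamma_tilde"
    using gens_carrier by (intro GT.generate_incl) auto
  show "carrier Gamma_tilde \<subseteq> generate Gamma_tilde {gen_p, gen_q}"
  proof
    fix f assume "f \<in> carrier Gamma_tilde"
    then obtain a b c d where A: "a \<in> dyadic" "b \<in> dyadic" "c \<in> dyadic" "d \<in> dyadic"
      "a * d - b * c = 1" "lifts_matrix a b c d f" by (auto simp: Gamma_tilde_iff)
    then have "covered a b c d" using covered_SL2 unfolding dyadic_def by blast
    then obtain g where g: "g \<in> generate Gamma_tilde {gen_p, gen_q}" "lifts_matrix a b c d g"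
      by (auto simp: covered_def)
    obtain k :: int where k: "\<And>t. f t = g t + 2 * pi * k" using lifts_matrix_unique[OF A(6) g(2)] by blast
    then have "f = (\<lambda>t. t + 2 * pi * real_of_int k) \<circ> g" by auto
    then show "f \<in> generate Gamma_tilde {gen_p, gen_q}"
      using generate.eng[OF generate_translation[of k] g(1)] by simp
  qed
qed

section \<open>Reduced forms and ping-pong\<close>

text \<open>Groups are written additively here without being commutative. The subgroup is built by
  left translation so that an induction peels off the leftmost letter.\<close>

inductive_set gen2 :: "'g::group_add \<Rightarrow> 'g \<Rightarrow> 'g set" for u v where
  zero: "0 \<in> gen2 u v"
| pos1: "x \<in> gen2 u v \<Longrightarrow> u + x \<in> gen2 u v"
| neg1: "x \<in> gen2 u v \<Longrightarrow> - u + x \<in> gen2 u v"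
| pos2: "x \<in> gen2 u v \<Longrightarrow> v + x \<in> gen2 u v"
| neg2: "x \<in> gen2 u v \<Longrightarrow> - v + x \<in> gen2 u v"

lemma gen2_add: "x \<in> gen2 u v \<Longrightarrow> y \<in> gen2 u v \<Longrightarrow> x + y \<in> gen2 u v"
  by (induction x rule: gen2.induct) (auto simp: add.assoc intro: gen2.intros simp del: add_uminus_conv_diff)

lemma gen2_gens: "u \<in> gen2 u v" "- u \<in> gen2 u v" "v \<in> gen2 u v" "- v \<in> gen2 u v"
  using gen2.intros(2-5)[OF gen2.zero[of u v]] by simp_all

lemma gen2_swap: "gen2 u v = gen2 v u"
proof -
  have "x \<in> gen2 v u" if "x \<in> gen2 u v" for x and u v :: 'a
    using that by induction (auto intro: gen2.intros)
  then show ?thesis by blast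
qed

text \<open>In the braid group on \<open>u\<close> and \<open>q\<close>, the subgroup generated by
  \<open>u\<close> and \<open>q + q\<close> has the coset representatives 0, \<open>q\<close> and
  \<open>u + q\<close>. These are the nonobvious entries of the table of left translations: each
  right-hand side is a representative followed by an element of the subgroup.\<close>

lemma braid_left_mult:
  fixes u q :: "'g::group_add"
  assumes b: "u + q + u = q + u + q"
  shows "u + (u + q) = q + (u + (q + q) + - u)" "q + q + (u + q) = u + q + (u + u)"
    "- u + q = u + q + (u + - (q + q) + - u)" "- (q + q) + (u + q) = u + q + (- u + - u)"
    "q + (u + q) = u + q + u"
proof -
  have b': "u + (q + u) = q + (u + q)" using b by (simp add: add.assoc)
  have b3: "u + (q + (u + x)) = q + (u + (q + x))" for x
    using arg_cong[OF b', of "\<lambda>y. y + x"] by (simp add: add.assoc)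
  show 1: "u + (u + q) = q + (u + (q + q) + - u)"
  proof -
    have "q + (u + (q + q) + - u) + u = u + (u + q) + u"
      by (simp add: add.assoc b3[symmetric] b' del: add_uminus_conv_diff)
    then show ?thesis by simp
  qed
  show 2: "q + q + (u + q) = u + q + (u + u)"
    by (simp add: add.assoc b3 b' flip: b')
  show "- u + q = u + q + (u + - (q + q) + - u)"
  proof -
    have "u + (u + q) + (u + - (q + q) + - u) = q"
      unfolding 1 by (simp add: add.assoc minus_add del: add_uminus_conv_diff)
    then have "u + (u + q + (u + - (q + q) + - u)) = q" by (simp only: add.assoc)
    then show ?thesis by (metis add.assoc add.left_neutral left_minus)
  qed
  show "- (q + q) + (u + q) = u + q + (- u + - u)"
  proof -
    have "q + q + (u + q + (- u + - u)) = (q + q + (u + q)) + (- u + - u)" by (simp only: add.assoc)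
    also have "\<dots> = u + q" unfolding 2 by (simp add: add.assoc del: add_uminus_conv_diff)
    finally show ?thesis by (metis add.assoc add.left_neutral left_minus)
  qed
  show "q + (u + q) = u + q + u" using b by (simp add: add.assoc)
qed

text \<open>Left translation by the subgroup permutes its nontrivial cosets, so \<open>c\<close> can
  be pushed through a representative to the right. Induction on \<open>c\<close> leaves only the
  generators and their inverses, for which \<open>braid_left_mult\<close> is the table.\<close>

lemma coset_left_mult:
  fixes u q :: "'g::group_add"
  assumes b: "u + q + u = q + u + q" and v: "v = q + q" and "c \<in> gen2 u v" "a \<in> {q, u + q}"
  shows "\<exists>a'\<in>{q, u + q}. \<exists>c'\<in>gen2 u v. c + a = a' + c'"
  using assms(3)
proof induction
  case zero
  then show ?case using assms(4) gen2.zero[of u v] by (intro bexI[of _ a] bexI[of _ 0]) auto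
next
  note B = braid_left_mult[OF b, folded v]
  have step: "\<exists>a'\<in>{q, u + q}. \<exists>c'\<in>gen2 u v. (s + x) + a = a' + c'"
    if s: "\<And>a'. a' \<in> {q, u + q} \<Longrightarrow> \<exists>a''\<in>{q, u + q}. \<exists>s'\<in>gen2 u v. s + a' = a'' + s'"
      and IH: "\<exists>a'\<in>{q, u + q}. \<exists>c'\<in>gen2 u v. x + a = a' + c'" for s x
  proof -
    obtain a' c' where 1: "a' \<in> {q, u + q}" "c' \<in> gen2 u v" "x + a = a' + c'" using IH by blast
    obtain a'' s' where 2: "a'' \<in> {q, u + q}" "s' \<in> gen2 u v" "s + a' = a'' + s'" using s[OF 1(1)] by blast
    have "(s + x) + a = a'' + (s' + c')" by (metis add.assoc 1(3) 2(3))
    then show ?thesis using 2(1) gen2_add[OF 2(2) 1(2)] by blast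
  qed
  have cl: "u + v + - u \<in> gen2 u v" "u + - v + - u \<in> gen2 u v" "u + u \<in> gen2 u v" "- u + - u \<in> gen2 u v"
    by (intro gen2_add gen2_gens)+
  have qv: "v + q = q + v" "- v + q = q + - v"
    unfolding v by (simp_all add: add.assoc minus_add del: add_uminus_conv_diff)
  have "u + q = (u + q) + 0" "- u + (u + q) = q + 0" by simp_all
  note S = this B(1-4) qv
  {
    case (pos1 x)
    show ?case by (rule step[OF _ pos1(2)]) (use S cl gen2_gens gen2.zero in blast)
  next
    case (neg1 x)
    show ?case by (rule step[OF _ neg1(2)]) (use S cl gen2_gens gen2.zero in blast)
  next
    case (pos2 x)
    show ?case by (rule step[OF _ pos2(2)]) (use S cl gen2_gens gen2.zero in blast)
  next
    case (neg2 x)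
    show ?case by (rule step[OF _ neg2(2)]) (use S cl gen2_gens gen2.zero in blast)
  }
qed

definition zmul :: "int \<Rightarrow> 'g::group_add \<Rightarrow> 'g" where
  "zmul k x = (if k \<ge> 0 then ((+) x ^^ nat k) 0 else ((+) (- x) ^^ nat (- k)) 0)"

lemma zmul_0 [simp]: "zmul 0 x = 0" by (simp add: zmul_def)

lemma zmul_succ: "x + zmul k x = zmul (k + 1) x"
proof (cases "k \<ge> 0")
  case True
  then have "nat (k + 1) = Suc (nat k)" by simp
  then show ?thesis using True by (simp add: zmul_def)
next
  case False
  then have "nat (- k) = Suc (nat (- (k + 1)))" by simp
  then show ?thesis using False by (auto simp: zmul_def)
qed

lemma zmul_pred: "- x + zmul k x = zmul (k - 1) x"
  using zmul_succ[of x "k - 1"] by (metis add.assoc add.left_neutral diff_add_cancel left_minus)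

lemma commute_uminus:
  assumes "x + y = y + (x :: 'g::group_add)"
  shows "- x + y = y + - x"
proof -
  have "x + (y + - x) = y" unfolding add.assoc[symmetric] assms by simp
  then have "- x + y = - x + (x + (y + - x))" by simp
  then show ?thesis by (simp only: minus_add_cancel)
qed

lemma zmul_commute:
  assumes "x + t = t + (x :: 'g::group_add)"
  shows "x + zmul k t = zmul k t + x"
proof -
  have *: "x + (s + z) = s + z + x" if "x + s = s + x" "x + z = z + x" for s z
    by (simp only: that add.assoc flip: add.assoc[of x])
  show ?thesis
  proof (induction k rule: int_induct[where k=0])
    case (step1 i) show ?case unfolding zmul_succ[symmetric] by (rule *[OF assms step1(2)])
  next
    case (step2 i) show ?case
      unfolding zmul_pred[symmetric] by (rule *[OF commute_uminus[OF assms[symmetric], symmetric] step2(2)])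
  qed simp
qed

text \<open>The setting isolates what may be used about the presented group: its relators, its
  generators and its map to lifts. The goal is \<open>kernel_trivial\<close>, the injectivity of
  this map.\<close>

locale two_generator_lift =
  fixes P Q :: "'g::group_add" and \<phi> :: "'g \<Rightarrow> real \<Rightarrow> real"
  assumes rel1: "P + P + Q + P + P = Q + P + P + Q"
    and rel2: "P + Q + Q + P = Q + Q + P + Q + Q"
    and generated: "x \<in> gen2 P Q"
    and map_zero: "\<phi> 0 = id" and map_add: "\<phi> (x + y) = \<phi> x \<circ> \<phi> y"
    and map_P: "\<phi> P = gen_p" and map_Q: "\<phi> Q = gen_q"
begin

definition "u = P + P"
definition "v = Q + Q"

lemma braid_u: "u + Q + u = Q + u + Q" and braid_v: "v + P + v = P + v + P"
  using rel1 rel2 by (simp_all add: u_def v_def add.assoc)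

abbreviation C where "C \<equiv> gen2 u v"

text \<open>Nonempty alternating products of representatives of the nontrivial left cosets of \<open>C\<close> in
  \<open>\<langle>u, Q\<rangle>\<close> and in \<open>\<langle>P, v\<rangle>\<close>, followed by an element of \<open>C\<close>.\<close>
inductive_set TA and TB where
  "a \<in> {Q, u + Q} \<Longrightarrow> y \<in> C \<Longrightarrow> a + y \<in> TA"
| "a \<in> {Q, u + Q} \<Longrightarrow> y \<in> TB \<Longrightarrow> a + y \<in> TA"
| "b \<in> {P, v + P} \<Longrightarrow> y \<in> C \<Longrightarrow> b + y \<in> TB"
| "b \<in> {P, v + P} \<Longrightarrow> y \<in> TA \<Longrightarrow> b + y \<in> TB"

text \<open>The pairs \<open>u\<close>, \<open>Q\<close> and \<open>v\<close>, \<open>P\<close> have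
  the same shape: \<open>v\<close> is twice \<open>Q\<close> and \<open>u\<close> is twice
  \<open>P\<close>. Hence \<open>coset_left_mult\<close> serves for both factors of the
  amalgam.\<close>

lemma C_left: "c \<in> C \<Longrightarrow> a \<in> {Q, u + Q} \<Longrightarrow> \<exists>a'\<in>{Q, u + Q}. \<exists>c'\<in>C. c + a = a' + c'"
  "c \<in> C \<Longrightarrow> b \<in> {P, v + P} \<Longrightarrow> \<exists>b'\<in>{P, v + P}. \<exists>c'\<in>C. c + b = b' + c'"
  using coset_left_mult[OF braid_u v_def, of c a] coset_left_mult[OF braid_v u_def, of c b]
  unfolding gen2_swap[of v u] by blast+

lemma C_left_T:
  "x \<in> TA \<Longrightarrow> \<forall>c\<in>C. c + x \<in> TA" "x \<in> TB \<Longrightarrow> \<forall>c\<in>C. c + x \<in> TB"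
proof (induction rule: TA_TB.inducts)
  case (1 a y)
  show ?case
  proof
    fix c assume "c \<in> C"
    then obtain a' c' where "a' \<in> {Q, u + Q}" "c' \<in> C" "c + a = a' + c'" using C_left(1) 1(1) by blast
    then show "c + (a + y) \<in> TA" using 1 by (metis add.assoc gen2_add TA_TB.intros(1))
  qed
next
  case (2 a y)
  show ?case
  proof
    fix c assume "c \<in> C"
    then obtain a' c' where "a' \<in> {Q, u + Q}" "c' \<in> C" "c + a = a' + c'" using C_left(1) 2(1) by blast
    then show "c + (a + y) \<in> TA" using 2 by (metis add.assoc TA_TB.intros(2))
  qed
next
  case (3 a y)
  show ?case
  proof
    fix c assume "c \<in> C"
    then obtain a' c' where "a' \<in> {P, v + P}" "c' \<in> C" "c + a = a' + c'" using C_left(2) 3(1) by blast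
    then show "c + (a + y) \<in> TB" using 3 by (metis add.assoc gen2_add TA_TB.intros(3))
  qed
next
  case (4 a y)
  show ?case
  proof
    fix c assume "c \<in> C"
    then obtain a' c' where "a' \<in> {P, v + P}" "c' \<in> C" "c + a = a' + c'" using C_left(2) 4(1) by blast
    then show "c + (a + y) \<in> TB" using 4 by (metis add.assoc TA_TB.intros(4))
  qed
qed

lemma C_left_closed: "c \<in> C \<Longrightarrow> x \<in> C \<union> TA \<union> TB \<Longrightarrow> c + x \<in> C \<union> TA \<union> TB"
  using C_left_T gen2_add by blast

text \<open>Two adjacent factors of the same type merge: \<open>Q + Q\<close> is \<open>v\<close>,
  and \<open>Q + (u + Q)\<close> is the representative \<open>u + Q\<close> followed by
  \<open>u\<close>; likewise for \<open>P\<close> and \<open>v\<close>. The surplus element of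
  \<open>C\<close> is absorbed on the right.\<close>

lemma P_Q_left_closed:
  assumes "x \<in> C \<union> TA \<union> TB"
  shows "Q + x \<in> C \<union> TA \<union> TB" "P + x \<in> C \<union> TA \<union> TB"
proof -
  have A: "Q + (Q + y) = v + y" "Q + (u + Q + y) = u + Q + (u + y)"
    "P + (P + y) = u + y" "P + (v + P + y) = v + P + (v + y)" for y
    using arg_cong[OF braid_left_mult(5)[OF braid_u], of "\<lambda>z. z + y"]
      arg_cong[OF braid_left_mult(5)[OF braid_v], of "\<lambda>z. z + y"]
    by (simp_all add: add.assoc v_def u_def)
  consider "x \<in> C" | "x \<in> TA" | "x \<in> TB" using assms by blast
  then show "Q + x \<in> C \<union> TA \<union> TB"
  proof cases
    case 2
    then show ?thesis
    proof cases
      case (1 a y)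
      have "u + y \<in> C" "v + y \<in> C" using 1(3) gen2.intros by blast+
      then show ?thesis using 1 A TA_TB.intros(1)[of "u + Q" "u + y"] by auto
    next
      case (2 a y)
      have "u + y \<in> TB" "v + y \<in> TB" using C_left_T(2)[OF 2(3)] gen2_gens by blast+
      then show ?thesis using 2 A TA_TB.intros(2)[of "u + Q" "u + y"] by auto
    qed
  qed (auto intro: TA_TB.intros)
  consider "x \<in> C" | "x \<in> TA" | "x \<in> TB" using assms by blast
  then show "P + x \<in> C \<union> TA \<union> TB"
  proof cases
    case 3
    then show ?thesis
    proof cases
      case (1 a y)
      have "u + y \<in> C" "v + y \<in> C" using 1(3) gen2.intros by blast+
      then show ?thesis using 1 A TA_TB.intros(3)[of "v + P" "v + y"] by auto
    next
      case (2 a y)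
      have "u + y \<in> TA" "v + y \<in> TA" using C_left_T(1)[OF 2(3)] gen2_gens by blast+
      then show ?thesis using 2 A TA_TB.intros(4)[of "v + P" "v + y"] by auto
    qed
  qed (auto intro: TA_TB.intros)
qed

text \<open>This is the existence half of the amalgam normal form. That the forms in
  \<open>TA\<close> and \<open>TB\<close> are nontrivial is read off from matrices in
  \<open>mlift_T\<close>.\<close>

lemma normal_form: "x \<in> C \<union> TA \<union> TB"
  using generated[of x]
proof (induction rule: gen2.induct)
  case zero show ?case using gen2.zero by blast
next
  case (pos1 x) show ?case by (rule P_Q_left_closed(2)[OF pos1(2)])
next
  case (pos2 x) show ?case by (rule P_Q_left_closed(1)[OF pos2(2)])
next
  case (neg1 x)
  \<comment> \<open>Inverse letters reduce to positive ones because the squares of \<open>P\<close>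
    and \<open>Q\<close> lie in \<open>C\<close>.\<close>
  have "- P + x = P + (- u + x)" by (simp add: u_def minus_add add.assoc del: add_uminus_conv_diff)
  then show ?case using P_Q_left_closed(2) C_left_closed[OF gen2_gens(2) neg1(2)] by simp
next
  case (neg2 x)
  have "- Q + x = Q + (- v + x)" by (simp add: v_def minus_add add.assoc del: add_uminus_conv_diff)
  then show ?case using P_Q_left_closed(1) C_left_closed[OF gen2_gens(4) neg2(2)] by simp
qed

section \<open>Matrices of group elements and the 2-adic ping-pong\<close>

definition mlift :: "real \<Rightarrow> real \<Rightarrow> real \<Rightarrow> real \<Rightarrow> 'g \<Rightarrow> bool" where
  "mlift a b c d x \<longleftrightarrow> lifts_matrix a b c d (\<phi> x) \<and> a * d - b * c = 1"

lemma mlift_add: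
  assumes "mlift a b c d x" "mlift a' b' c' d' y"
  shows "mlift (a*a'+b*c') (a*b'+b*d') (c*a'+d*c') (c*b'+d*d') (x + y)"
proof -
  have "(a*a'+b*c') * (c*b'+d*d') - (a*b'+b*d') * (c*a'+d*c') = (a * d - b * c) * (a' * d' - b' * c')"
    by algebra
  then show ?thesis using assms unfolding mlift_def map_add by (auto intro: lifts_matrix_comp)
qed

lemma mlift_0: "mlift 1 0 0 1 0"
  by (simp add: mlift_def map_zero lifts_matrix_id)

lemma mlift_P: "mlift 1 (1/2) 0 1 P" and mlift_Q: "mlift 1 0 (-1) 1 Q"
  by (simp_all add: mlift_def map_P map_Q lifts_gen_p lifts_gen_q)

lemma map_uminus: "\<phi> (- x) \<circ> \<phi> x = id" "\<phi> x \<circ> \<phi> (- x) = id"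
  by (simp_all flip: map_add map_zero)

lemma mlift_uminus:
  assumes "mlift a b c d x" shows "mlift d (-b) (-c) a (- x)"
proof -
  have det: "d * a - (-b) * (-c) = 1" using assms by (simp add: mlift_def algebra_simps)
  then obtain g where g: "lifts_matrix d (-b) (-c) a g" using lifts_matrix_exists by blast
  have "lifts_matrix 1 0 0 1 (g \<circ> \<phi> x)"
    using lifts_matrix_comp[OF g, of a b c d "\<phi> x"] assms by (simp add: mlift_def algebra_simps)
  then obtain k :: int where k: "\<And>t. (g \<circ> \<phi> x) t = id t + 2 * pi * k"
    using lifts_matrix_unique[OF _ lifts_matrix_id] by metis
  have "\<phi> (- x) = (\<lambda>t. g t + 2 * pi * real_of_int (- k))"
  proof
    fix t
    have "g (\<phi> x (\<phi> (- x) t)) = \<phi> (- x) t + 2 * pi * k" using k by simp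
    moreover have "\<phi> x (\<phi> (- x) t) = t" using map_uminus(2)[of x] by (metis comp_apply id_apply)
    ultimately show "\<phi> (- x) t = g t + 2 * pi * real_of_int (- k)" by simp
  qed
  then show ?thesis using lifts_matrix_shift[OF g, of "-k"] det by (simp add: mlift_def)
qed

lemma mlift_u: "mlift 1 1 0 1 u" and mlift_v: "mlift 1 0 (-2) 1 v"
  using mlift_add[OF mlift_P mlift_P] mlift_add[OF mlift_Q mlift_Q] by (simp_all add: u_def v_def)

text \<open>These are the congruences of Gamma_0(2), preserved by the generators and their inverses.
  They place the columns in \<open>PB 0\<close> and \<open>PA 0\<close>, where the ping-pong
  starts.\<close>

lemma mlift_C:
  assumes "x \<in> C"
  shows "\<exists>(a::int) (b::int) (c::int) (d::int). mlift a b c d x \<and> odd a \<and> even c \<and> odd d"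
  using assms
proof (induction rule: gen2.induct)
  case zero
  show ?case using mlift_0 by (intro exI[of _ 1] exI[of _ 0]) auto
next
  case (pos1 x)
  then obtain a b c d :: int where x: "mlift a b c d x" "odd a" "even c" "odd d" by blast
  show ?case using mlift_add[OF mlift_u x(1)] x(2-4)
    by (intro exI[of _ "a + c"] exI[of _ "b + d"] exI[of _ c] exI[of _ d]) auto
next
  case (neg1 x)
  then obtain a b c d :: int where x: "mlift a b c d x" "odd a" "even c" "odd d" by blast
  show ?case using mlift_add[OF mlift_uminus[OF mlift_u] x(1)] x(2-4)
    by (intro exI[of _ "a - c"] exI[of _ "b - d"] exI[of _ c] exI[of _ d]) auto
next
  case (pos2 x)
  then obtain a b c d :: int where x: "mlift a b c d x" "odd a" "even c" "odd d" by blast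
  show ?case using mlift_add[OF mlift_v x(1)] x(2-4)
    by (intro exI[of _ a] exI[of _ b] exI[of _ "c - 2 * a"] exI[of _ "d - 2 * b"]) auto
next
  case (neg2 x)
  then obtain a b c d :: int where x: "mlift a b c d x" "odd a" "even c" "odd d" by blast
  show ?case using mlift_add[OF mlift_uminus[OF mlift_v] x(1)] x(2-4)
    by (intro exI[of _ a] exI[of _ b] exI[of _ "c + 2 * a"] exI[of _ "d + 2 * b"]) (auto simp: add.commute)
qed

text \<open>A matrix column \<open>(X, Y)\<close> has 2-adic size \<open>2^k\<close> and points to one of the two halves into which the
  edge stabilised by \<open>C\<close> cuts the Bass-Serre tree.\<close>
definition PA :: "nat \<Rightarrow> real \<Rightarrow> real \<Rightarrow> bool" where
  "PA k X Y \<longleftrightarrow> (\<exists>(m::int) (n::int). X = m / 2 ^ k \<and> Y = n / 2 ^ k \<and> odd n)"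
definition PB :: "nat \<Rightarrow> real \<Rightarrow> real \<Rightarrow> bool" where
  "PB k X Y \<longleftrightarrow> (\<exists>(m::int) (n::int). X = m / 2 ^ k \<and> Y = n / 2 ^ k \<and> odd m \<and> even n)"

text \<open>The two vectors are the images of the column under \<open>Q\<close> and
  \<open>u + Q\<close>. These matrices are integral, so the denominator stays.\<close>

lemma PB_imp_PA:
  assumes "PB k X Y" shows "PA k X (Y - X)" "PA k Y (Y - X)"
proof -
  obtain m n :: int where *: "X = m / 2 ^ k" "Y = n / 2 ^ k" "odd m" "even n" using assms by (auto simp: PB_def)
  then have "Y - X = (n - m) / 2 ^ k" "odd (n - m)" by (auto simp: diff_divide_distrib)
  then show "PA k X (Y - X)" "PA k Y (Y - X)" using * unfolding PA_def by (metis of_int_diff)+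
qed

text \<open>The two vectors are the images of the column under \<open>P\<close> and
  \<open>v + P\<close>. The odd lower numerator makes the new upper numerator
  \<open>2 * m + n\<close> odd, so the denominator really doubles.\<close>

lemma PA_imp_PB:
  assumes "PA k X Y" shows "PB (Suc k) (X + Y / 2) Y" "PB (Suc k) (X + Y / 2) (- 2 * X)"
proof -
  obtain m n :: int where *: "X = m / 2 ^ k" "Y = n / 2 ^ k" "odd n" using assms by (auto simp: PA_def)
  then have "X + Y / 2 = real_of_int (2 * m + n) / 2 ^ Suc k" "Y = real_of_int (2 * n) / 2 ^ Suc k"
    "- 2 * X = real_of_int (- 4 * m) / 2 ^ Suc k" "odd (2 * m + n)" "even (2 * n)" "even (- 4 * m)"
    by (auto simp: field_simps)
  then show "PB (Suc k) (X + Y / 2) Y" "PB (Suc k) (X + Y / 2) (- 2 * X)" unfolding PB_def by metis+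
qed

lemma PA_PB_not_unit:
  "k \<ge> 1 \<Longrightarrow> PA k X Y \<or> PB k X Y \<Longrightarrow> \<not> (X = real_of_int x \<and> Y = real_of_int y)"
proof
  assume k: "k \<ge> 1" and "PA k X Y \<or> PB k X Y" and XY: "X = real_of_int x \<and> Y = real_of_int y"
  then obtain m n :: int where mn: "X = m / 2 ^ k" "Y = n / 2 ^ k" "odd m \<or> odd n" by (auto simp: PA_def PB_def)
  then have "real_of_int m = real_of_int (x * 2 ^ k)" "real_of_int n = real_of_int (y * 2 ^ k)" using XY
    by (auto simp: field_simps)
  then have "m = x * 2 ^ k" "n = y * 2 ^ k" by linarith+
  then show False using mn(3) k by auto
qed

lemma mlift_left_A:
  assumes "a \<in> {Q, u + Q}" "mlift x y z w t"
  shows "\<exists>x' y' z' w'. mlift x' y' z' w' (a + t) \<and> (\<forall>k. PB k x z \<longrightarrow> PA k x' z') \<and> (\<forall>k. PB k y w \<longrightarrow> PA k y' w')"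
proof (cases "a = Q")
  case True
  have "mlift x y (z - x) (w - y) (a + t)" using mlift_add[OF mlift_Q assms(2)] True by simp
  then show ?thesis using PB_imp_PA by blast
next
  case False
  then have "a = u + Q" using assms by blast
  then have "mlift z w (z - x) (w - y) (a + t)" using mlift_add[OF mlift_add[OF mlift_u mlift_Q] assms(2)] by simp
  then show ?thesis using PB_imp_PA by blast
qed

lemma mlift_left_B:
  assumes "b \<in> {P, v + P}" "mlift x y z w t"
  shows "\<exists>x' y' z' w'. mlift x' y' z' w' (b + t) \<and>
     (\<forall>k. PA k x z \<longrightarrow> PB (Suc k) x' z') \<and> (\<forall>k. PA k y w \<longrightarrow> PB (Suc k) y' w')"
proof (cases "b = P")
  case True
  have "mlift (x + z / 2) (y + w / 2) z w (b + t)" using mlift_add[OF mlift_P assms(2)] True by simp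
  then show ?thesis using PA_imp_PB by blast
next
  case False
  then have "b = v + P" using assms by blast
  then have "mlift (x + z / 2) (y + w / 2) (- 2 * x) (- 2 * y) (b + t)"
    using mlift_add[OF mlift_add[OF mlift_v mlift_P] assms(2)] by simp
  then show ?thesis using PA_imp_PB by blast
qed

text \<open>One column is followed through the alternating product: the first if the rightmost
  representative is of type \<open>Q\<close>, the second if it is of type \<open>P\<close>. For the
  second column \<open>k = 0\<close> must be excluded, since (0, 1) satisfies \<open>PA 0\<close>;
  the first column (1, 0) of the identity does not, so \<open>k = 0\<close> is harmless
  there.\<close>

lemma mlift_T:
  "s \<in> TA \<Longrightarrow> \<exists>x y z w. mlift x y z w s \<and> (\<exists>k. PA k x z \<or> (k \<ge> 1 \<and> PA k y w))"
  "s \<in> TB \<Longrightarrow> \<exists>x y z w. mlift x y z w s \<and> (\<exists>k\<ge>1. PB k x z \<or> PB k y w)"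
proof (induction rule: TA_TB.inducts)
  case (1 a s)
  obtain x y z w :: int where s: "mlift x y z w s" "odd x" "even z" "odd w" using mlift_C[OF 1(2)] by blast
  then have "PB 0 x z" unfolding PB_def by auto
  then show ?case using mlift_left_A[OF 1(1) s(1)] by blast
next
  case (2 a s)
  then obtain x y z w where s: "mlift x y z w s" "\<exists>k\<ge>1. PB k x z \<or> PB k y w" by blast
  then show ?case using mlift_left_A[OF 2(1) s(1)] by blast
next
  case (3 b s)
  obtain x y z w :: int where s: "mlift x y z w s" "odd x" "even z" "odd w" using mlift_C[OF 3(2)] by blast
  then have "PA 0 y w" unfolding PA_def by auto
  then show ?case using mlift_left_B[OF 3(1) s(1)] by fastforce
next
  case (4 b s)
  then obtain x y z w where s: "mlift x y z w s" "\<exists>k. PA k x z \<or> (k \<ge> 1 \<and> PA k y w)" by blast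
  then show ?case using mlift_left_B[OF 4(1) s(1)] by fastforce
qed

lemma mlift_id_imp: "mlift a b c d x \<Longrightarrow> \<phi> x = id \<Longrightarrow> a = 1 \<and> b = 0 \<and> c = 0 \<and> d = 1"
  using lifts_matrix_id_imp by (auto simp: mlift_def)

lemma kernel_in_C:
  assumes "\<phi> s = id" shows "s \<in> C"
proof (rule ccontr)
  assume "s \<notin> C"
  then consider "s \<in> TA" | "s \<in> TB" using normal_form by blast
  then show False
  proof cases
    case 1
    then obtain x y z w k where *: "mlift x y z w s" "PA k x z \<or> (k \<ge> 1 \<and> PA k y w)" using mlift_T(1) by blast
    have "k \<noteq> 0"
    proof
      assume "k = 0"
      then obtain n :: int where "z = n" "odd n" using *(2) by (auto simp: PA_def)
      then show False using mlift_id_imp[OF *(1) assms] by auto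
    qed
    then show False using *(2) mlift_id_imp[OF *(1) assms] PA_PB_not_unit[of k x z 1 0] PA_PB_not_unit[of k y w 0 1]
      by auto
  next
    case 2
    then obtain x y z w k where *: "mlift x y z w s" "PB k x z \<or> PB k y w" "k \<ge> 1" using mlift_T(2) by blast
    then show False using mlift_id_imp[OF *(1) assms] PA_PB_not_unit[of k x z 1 0] PA_PB_not_unit[of k y w 0 1]
      by auto
  qed
qed

definition "w = u + v"
definition "t = w + w"

lemma t_square: "t = u + Q + u + (u + Q + u)"
proof -
  have "t = u + Q + (Q + u + Q) + Q" by (simp add: t_def w_def v_def add.assoc)
  also have "\<dots> = (u + Q + u) + (Q + u + Q)" by (subst braid_u[symmetric]) (simp only: add.assoc)
  finally show ?thesis by (simp only: braid_u)
qed

lemma t_commute: "u + t = t + u" "w + t = t + w"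
proof -
  have "v + u + v + u = Q + (Q + u + Q) + Q + u" by (simp add: v_def add.assoc)
  also have "\<dots> = (Q + u + Q) + (u + Q + u)" by (subst braid_u[symmetric]) (simp only: add.assoc)
  also have "\<dots> = u + v + u + v" using t_square unfolding braid_u t_def w_def by (simp only: add.assoc)
  finally have 1: "u + v + u + v = v + u + v + u" by simp
  have "t + u = u + (v + u + v + u)" by (simp only: t_def w_def add.assoc)
  also have "\<dots> = u + t" unfolding 1[symmetric] by (simp only: t_def w_def add.assoc)
  finally show "u + t = t + u" ..
  show "w + t = t + w" unfolding t_def by (simp add: add.assoc)
qed

lemma map_t: "\<phi> t = (\<lambda>s. s - pi)"
proof -
  have "\<phi> (u + Q + u) = (\<lambda>s. s - pi/2)"
    using gens_rotation by (simp add: map_add u_def map_P map_Q comp_assoc)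
  then show ?thesis unfolding t_square map_add[of "u + Q + u"] by (auto simp: fun_eq_iff)
qed

lemma map_zmul_t: "\<phi> (zmul k t) s = s - real_of_int k * pi"
proof (induction k arbitrary: s rule: int_induct[where k=0])
  case base then show ?case by (simp add: map_zero)
next
  case (step1 i) then show ?case
    unfolding zmul_succ[symmetric] map_add by (simp add: map_t algebra_simps)
next
  case (step2 i)
  have "\<phi> (- t) s = s + pi" for s
    using fun_cong[OF map_uminus(1)[of t], of "s + pi"] by (simp add: map_t)
  then show ?case using step2 unfolding zmul_pred[symmetric] map_add by (simp add: algebra_simps)
qed

lemma mlift_zmul_u: "mlift 1 (real_of_int k) 0 1 (zmul k u)"
proof (induction k rule: int_induct[where k=0])
  case base then show ?case using mlift_0 by simp
next
  case (step1 i) then show ?case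
    using mlift_add[OF mlift_u step1(2)] by (simp add: zmul_succ add.commute)
next
  case (step2 i) then show ?case
    using mlift_add[OF mlift_uminus[OF mlift_u] step2(2)] by (simp add: zmul_pred)
qed

lemma map_zmul_u_0: "\<phi> (zmul k u) 0 = 0"
proof -
  have p0: "\<phi> u 0 = 0" by (simp add: u_def map_add map_P gen_p_def upper_lift_0)
  then have n0: "\<phi> (- u) 0 = 0" using fun_cong[OF map_uminus(1)[of u], of 0] by simp
  show ?thesis
  proof (induction k rule: int_induct[where k=0])
    case base then show ?case by (simp add: map_zero)
  next
    case (step1 i) then show ?case using p0 by (simp add: zmul_succ[symmetric] map_add)
  next
    case (step2 i) then show ?case using n0 by (simp add: zmul_pred[symmetric] map_add)
  qed
qed

text \<open>Modulo the central element \<open>t\<close>, the group \<open>C\<close> is the free product of \<open>\<langle>u\<rangle>\<close> and \<open>\<langle>w\<rangle>\<close>; \<open>W\<close>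
  consists of the reduced words that begin with \<open>w\<close>.\<close>
inductive_set W where
  W_last: "w + (zmul k u + 0) \<in> W"
| W_step: "k \<noteq> 0 \<Longrightarrow> y \<in> W \<Longrightarrow> w + (zmul k u + y) \<in> W"

text \<open>The inequality says that a/c, the image of infinity under the Moebius map of
  \<open>y\<close>, lies strictly between 0 and 1. A nonzero integer translation moves that interval
  off [0, 1], and \<open>w\<close> maps the complement of [0, 1] back into it. The base point is the
  image 1/2 of infinity under \<open>w\<close>.\<close>

lemma W_column:
  assumes "y \<in> W" shows "\<exists>a b c d. mlift a b c d y \<and> \<bar>2 * a - c\<bar> < \<bar>c\<bar>"
proof -
  have w: "mlift (-1) 1 (-2) 1 w" using mlift_add[OF mlift_u mlift_v] by (simp add: w_def)
  show ?thesis
    using assms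
  proof induction
    case (W_last k)
    show ?case using mlift_add[OF w mlift_zmul_u[of k]] by fastforce
  next
    case (W_step k y)
    then obtain a b c d where y: "mlift a b c d y" "\<bar>2 * a - c\<bar> < \<bar>c\<bar>" by blast
    define e where "e = k * c"
    define a' where "a' = a + e"
    have "1 \<le> \<bar>real_of_int k\<bar>" using W_step(1) by linarith
    then have "1 * \<bar>c\<bar> \<le> \<bar>real_of_int k\<bar> * \<bar>c\<bar>" by (intro mult_right_mono) auto
    then have "\<bar>c\<bar> \<le> \<bar>e\<bar>" by (simp add: abs_mult e_def)
    moreover have "2 * \<bar>e\<bar> \<le> \<bar>2 * a' - c\<bar> + \<bar>2 * a - c\<bar>"
      using abs_triangle_ineq4[of "2 * a' - c" "2 * a - c"] by (simp add: a'_def abs_mult)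
    \<comment> \<open>The translated point a'/c lies outside [0, 1].\<close>
    ultimately have "\<bar>c\<bar> < \<bar>2 * a' - c\<bar>" using y(2) by linarith
    then have "\<bar>2 * (- a' + c) - (- 2 * a' + c)\<bar> < \<bar>- 2 * a' + c\<bar>" by (simp add: abs_minus_commute)
    then show ?case using mlift_add[OF w mlift_add[OF mlift_zmul_u[of k] y(1)]]
      by (intro exI conjI) (assumption, simp add: a'_def e_def)
  qed
qed

definition NC where "NC = {zmul m t + (zmul k u + y) | m k y. y = 0 \<or> y \<in> W}"

text \<open>Closure under these four translations covers all of \<open>C\<close>, because
  \<open>v\<close> is \<open>- u + w\<close> and \<open>- v\<close> is
  \<open>- t + w + u\<close>.\<close>

lemma NC_left:
  assumes "x \<in> NC"
  shows "u + x \<in> NC" "- u + x \<in> NC" "w + x \<in> NC" "- t + x \<in> NC"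
proof -
  obtain m k y where x: "x = zmul m t + (zmul k u + y)" "y = 0 \<or> y \<in> W" using assms by (auto simp: NC_def)
  have cu: "- u + t = t + - u" using commute_uminus[OF t_commute(1)] .
  have "u + x = zmul m t + (zmul (k + 1) u + y)"
    unfolding x zmul_succ[symmetric] add.assoc[symmetric] zmul_commute[OF t_commute(1)] ..
  then show "u + x \<in> NC" using x(2) unfolding NC_def by blast
  have "- u + x = zmul m t + (zmul (k - 1) u + y)"
    unfolding x zmul_pred[symmetric] add.assoc[symmetric] zmul_commute[OF cu] ..
  then show "- u + x \<in> NC" using x(2) unfolding NC_def by blast
  have "- t + x = zmul (m - 1) t + (zmul k u + y)"
    unfolding x zmul_pred[symmetric] by (simp add: add.assoc)
  then show "- t + x \<in> NC" using x(2) unfolding NC_def by blast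
  have wx: "w + x = zmul m t + (w + (zmul k u + y))"
    unfolding x add.assoc[symmetric] zmul_commute[OF t_commute(2)] ..
  show "w + x \<in> NC"
  proof (cases "k = 0 \<and> y \<in> W")
    \<comment> \<open>Here two letters \<open>w\<close> meet. They combine to \<open>t\<close>,
      which moves to the central power in front.\<close>
    case True
    then obtain k' y' where y: "y = w + (zmul k' u + y')" "y' = 0 \<or> y' \<in> W" by (blast elim: W.cases)
    have "w + x = zmul m t + t + (zmul k' u + y')"
      unfolding wx using True y by (simp add: t_def add.assoc)
    also have "zmul m t + t = zmul (m + 1) t"
      using zmul_commute[of t t m] by (simp add: zmul_succ)
    finally show ?thesis using y(2) unfolding NC_def by blast
  next
    case False
    then have "w + (zmul k u + y) \<in> W" using x(2) W.intros by blast
    moreover have "w + x = zmul m t + (zmul 0 u + (w + (zmul k u + y)))" unfolding wx by simp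
    ultimately show ?thesis unfolding NC_def by blast
  qed
qed

lemma C_subset_NC: "x \<in> C \<Longrightarrow> x \<in> NC"
proof (induction rule: gen2.induct)
  case zero
  have "0 = zmul 0 t + (zmul 0 u + 0)" by simp
  then show ?case unfolding NC_def by blast
next
  case (pos1 x) show ?case by (rule NC_left(1)[OF pos1(2)])
next
  case (neg1 x) show ?case by (rule NC_left(2)[OF neg1(2)])
next
  case (pos2 x)
  have "v + x = - u + (w + x)" by (simp add: w_def add.assoc)
  then show ?case using NC_left pos2 by simp
next
  case (neg2 x)
  have "- v + x = - t + (w + (u + x))"
    by (simp add: t_def w_def minus_add add.assoc del: add_uminus_conv_diff)
  then show ?case using NC_left neg2 by simp
qed

lemma kernel_trivial:
  assumes "\<phi> x = id" shows "x = 0"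
proof -
  obtain m k y where x: "x = zmul m t + (zmul k u + y)" "y = 0 \<or> y \<in> W"
    using C_subset_NC[OF kernel_in_C[OF assms]] by (auto simp: NC_def)
  \<comment> \<open>Since \<open>zmul m t\<close> lowers every angle by m pi, the remaining factor
    must raise 0 to m pi. Its matrix thus preserves the horizontal line, which
    \<open>W_column\<close> forbids for \<open>y\<close> in \<open>W\<close>.\<close>
  have val: "\<phi> (zmul k u + y) 0 = m * pi"
    using assms map_zmul_t[of m "\<phi> (zmul k u + y) 0"] by (simp add: x(1) map_add fun_eq_iff)
  have "y \<notin> W"
  proof
    assume "y \<in> W"
    then obtain a b c d where y: "mlift a b c d y" "\<bar>2 * a - c\<bar> < \<bar>c\<bar>" using W_column by blast
    have "lifts_matrix (a + k * c) (b + k * d) c d (\<phi> (zmul k u + y))"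
      using mlift_add[OF mlift_zmul_u[of k] y(1)] by (simp add: mlift_def)
    then obtain r where "c * cos 0 + d * sin 0 = r * sin (\<phi> (zmul k u + y) 0)"
      unfolding lifts_matrix_def by blast
    moreover have "sin (m * pi) = 0" by (auto simp: sin_zero_iff_int2)
    ultimately have "c = 0" unfolding val by simp
    then show False using y(2) by simp
  qed
  then have y: "y = 0" using x(2) by blast
  \<comment> \<open>The angle, not the matrix, decides here: \<open>zmul k u\<close> fixes the angle
    0 exactly, which leaves no room for a rotation by a multiple of 2 pi.\<close>
  then have "m = 0" using val map_zmul_u_0 by simp
  then have "x = zmul k u" using x y by simp
  then show ?thesis using mlift_id_imp[OF mlift_zmul_u[of k]] assms by simp
qed

end

section \<open>The presentation\<close>

lemma pres_eq_append: "pres_eq R u u' \<Longrightarrow> pres_eq R v v' \<Longrightarrow> pres_eq R (u @ v) (u' @ v')"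
  using pres_eq.ctxt[of R u u' "[]" v] pres_eq.ctxt[of R v v' u' "[]"] pres_eq.trans by fastforce

definition inv_word :: "('a \<times> bool) list \<Rightarrow> ('a \<times> bool) list" where
  "inv_word w = rev (map (\<lambda>(s, b). (s, \<not> b)) w)"

lemma inv_word_inv_word [simp]: "inv_word (inv_word w) = w"
  by (induction w) (auto simp: inv_word_def rev_map)

lemma pres_eq_inv_right: "pres_eq R (w @ inv_word w) []"
proof (induction w)
  case Nil show ?case by (simp add: inv_word_def pres_eq.refl)
next
  case (Cons x w)
  obtain s b where x: "x = (s, b)" by fastforce
  have "(x # w) @ inv_word (x # w) = [x] @ (w @ inv_word w) @ [(s, \<not> b)]" by (simp add: inv_word_def x)
  also have "pres_eq R \<dots> ([x] @ [] @ [(s, \<not> b)])" by (rule pres_eq.ctxt[OF Cons])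
  also have "[x] @ [] @ [(s, \<not> b)] = [(s, b), (s, \<not> b)]" by (simp add: x)
  also have "pres_eq R \<dots> []" by (rule pres_eq.cancel)
  finally (pres_eq.trans) show ?case .
qed

lemma pres_eq_inv_left: "pres_eq R (inv_word w @ w) []"
  using pres_eq_inv_right[of R "inv_word w"] by simp

lemma pres_eq_inv_word:
  assumes "pres_eq R u v" shows "pres_eq R (inv_word u) (inv_word v)"
proof -
  have "pres_eq R ([] @ inv_word v) ((inv_word u @ u) @ inv_word v)"
    by (intro pres_eq_append pres_eq.sym[OF pres_eq_inv_left] pres_eq.refl)
  also have "(inv_word u @ u) @ inv_word v = inv_word u @ (u @ inv_word v)" by simp
  also have "pres_eq R \<dots> (inv_word u @ (v @ inv_word v))"
    by (intro pres_eq_append pres_eq.refl assms)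
  also (pres_eq.trans) have "pres_eq R \<dots> (inv_word u @ [])"
    by (intro pres_eq_append pres_eq.refl pres_eq_inv_right)
  finally (pres_eq.trans) show ?thesis by (simp add: pres_eq.sym)
qed

lemma pres_eq_map:
  assumes "pres_eq R u v" "\<And>r. r \<in> R \<Longrightarrow> map (map_prod \<sigma> id) r \<in> R'"
  shows "pres_eq R' (map (map_prod \<sigma> id) u) (map (map_prod \<sigma> id) v)"
  using assms(1)
proof induction
  case (refl w) show ?case by (rule pres_eq.refl)
next
  case (sym u v) then show ?case by (blast intro: pres_eq.sym)
next
  case (trans u v w) then show ?case by (blast intro: pres_eq.trans)
next
  case (ctxt u v p q) then show ?case unfolding map_append by (blast intro: pres_eq.ctxt)
next
  case (cancel s b) show ?case using pres_eq.cancel[of R' "\<sigma> s" b] by simp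
next
  case (rel r) then show ?case using pres_eq.rel[OF assms(2)] by (simp del: id_apply)
qed

context group begin

lemma word_eval_Nil [simp]: "word_eval G [] = \<one>"
  and word_eval_Cons: "word_eval G ((s, b) # w) = (if b then s else inv s) \<otimes> word_eval G w"
  by (simp_all add: word_eval_def)

lemma word_eval_closed: "set w \<subseteq> carrier G \<times> UNIV \<Longrightarrow> word_eval G w \<in> carrier G"
  by (induction w) (auto simp: word_eval_Cons)

lemma word_eval_append:
  "set u \<subseteq> carrier G \<times> UNIV \<Longrightarrow> set v \<subseteq> carrier G \<times> UNIV \<Longrightarrow>
    word_eval G (u @ v) = word_eval G u \<otimes> word_eval G v"
  by (induction u) (auto simp: word_eval_Cons word_eval_closed m_assoc)

text \<open>A derivation may insert cancelling pairs of any letters of the type, including letters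
  outside the alphabet. The substitution \<open>\<sigma>\<close> therefore has to send every letter
  into the carrier.\<close>

lemma pres_eq_word_eval:
  assumes "pres_eq R u v" and \<sigma>: "\<And>s. \<sigma> s \<in> carrier G"
    and R: "\<And>r. r \<in> R \<Longrightarrow> word_eval G (map (map_prod \<sigma> id) r) = \<one>"
  shows "word_eval G (map (map_prod \<sigma> id) u) = word_eval G (map (map_prod \<sigma> id) v)"
  using assms(1)
proof induction
  case (ctxt u v p q)
  have *: "set (map (map_prod \<sigma> id) w) \<subseteq> carrier G \<times> UNIV" for w :: "('c \<times> bool) list" using \<sigma> by auto
  have "word_eval G (map (map_prod \<sigma> id) (p @ w @ q)) =
    word_eval G (map (map_prod \<sigma> id) p) \<otimes> (word_eval G (map (map_prod \<sigma> id) w) \<otimes> word_eval G (map (map_prod \<sigma> id) q))" for w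
    unfolding map_append using word_eval_append[OF * *[of "w @ q"]] word_eval_append[OF * *]
    by (simp only: map_append)
  then show ?case by (simp only: ctxt.IH)
next
  case (cancel s b)
  show ?case using \<sigma> by (cases b) (auto simp: word_eval_Cons)
next
  case (rel r)
  then show ?case by (simp only: R list.map word_eval_Nil)
qed auto

lemma word_eval_surj:
  assumes "S \<subseteq> carrier G" "x \<in> generate G S"
  obtains w where "set w \<subseteq> S \<times> UNIV" "word_eval G w = x"
proof -
  have "\<exists>w. set w \<subseteq> S \<times> UNIV \<and> word_eval G w = x"
    using assms(2)
  proof induction
    case one show ?case by (intro exI[of _ "[]"]) auto
  next
    case (incl h) then show ?case using assms(1) by (intro exI[of _ "[(h, True)]"]) (auto simp: word_eval_Cons)
  next
    case (inv h) then show ?case using assms(1) by (intro exI[of _ "[(h, False)]"]) (auto simp: word_eval_Cons)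
  next
    case (eng x y)
    then obtain v w where "set v \<subseteq> S \<times> UNIV" "word_eval G v = x" "set w \<subseteq> S \<times> UNIV" "word_eval G w = y" by blast
    moreover from this have "set v \<subseteq> carrier G \<times> UNIV" "set w \<subseteq> carrier G \<times> UNIV" using assms(1) by blast+
    ultimately show ?case by (intro exI[of _ "v @ w"]) (auto simp: word_eval_append)
  qed
  then show ?thesis using that by blast
qed

end

text \<open>Each word is one side of a relation followed by the inverse of the other side.\<close>

definition relators :: "'a \<Rightarrow> 'a \<Rightarrow> ('a \<times> bool) list set" where
  "relators x y =
    {[(x, True), (x, True), (y, True), (x, True), (x, True), (y, False), (x, False), (x, False), (y, False)],
     [(x, True), (y, True), (y, True), (x, True), (y, False), (y, False), (x, False), (y, False), (y, False)]}"

lemma (in group) word_eval_relators: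
  assumes c: "x \<in> carrier G" "y \<in> carrier G"
    and r1: "x \<otimes> x \<otimes> y \<otimes> x \<otimes> x = y \<otimes> x \<otimes> x \<otimes> y"
    and r2: "x \<otimes> y \<otimes> y \<otimes> x = y \<otimes> y \<otimes> x \<otimes> y \<otimes> y"
    and r: "r \<in> relators x y"
  shows "word_eval G r = \<one>"
proof -
  consider "r = [(x, True), (x, True), (y, True), (x, True), (x, True), (y, False), (x, False), (x, False), (y, False)]"
    | "r = [(x, True), (y, True), (y, True), (x, True), (y, False), (y, False), (x, False), (y, False), (y, False)]"
    using r by (auto simp: relators_def)
  then show ?thesis
  proof cases
    case 1
    have "word_eval G r = (x \<otimes> x \<otimes> y \<otimes> x \<otimes> x) \<otimes> inv (y \<otimes> x \<otimes> x \<otimes> y)"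
      using c by (simp add: 1 word_eval_Cons inv_mult_group m_assoc)
    then show ?thesis using c by (simp add: r1)
  next
    case 2
    have "word_eval G r = (x \<otimes> y \<otimes> y \<otimes> x) \<otimes> inv (y \<otimes> y \<otimes> x \<otimes> y \<otimes> y)"
      using c by (simp add: 2 word_eval_Cons inv_mult_group m_assoc)
    then show ?thesis using c by (simp add: r2)
  qed
qed

lemma map_relators: "r \<in> relators x y \<Longrightarrow> map (map_prod \<sigma> id) r \<in> relators (\<sigma> x) (\<sigma> y)"
  by (auto simp: relators_def)

\<comment> \<open>With the two-element type \<open>bool\<close> as alphabet every word is a word in
  the two generators, so the presented group is a whole type and can be made an instance of
  \<open>group_add\<close>.\<close>
quotient_type presented = "(bool \<times> bool) list" / "pres_eq (relators True False)"
  by (rule equivpI) (auto intro!: reflpI sympI transpI intro: pres_eq.refl pres_eq.sym pres_eq.trans)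

instantiation presented :: group_add
begin

lift_definition zero_presented :: presented is "[]" .
lift_definition plus_presented :: "presented \<Rightarrow> presented \<Rightarrow> presented" is "(@)" by (rule pres_eq_append)
lift_definition uminus_presented :: "presented \<Rightarrow> presented" is inv_word by (rule pres_eq_inv_word)
definition minus_presented :: "presented \<Rightarrow> presented \<Rightarrow> presented" where "minus_presented x y = x + - y"

instance
proof
  fix a b c :: presented
  show "a + b + c = a + (b + c)" by transfer (simp add: pres_eq.refl)
  show "0 + a = a" "a + 0 = a" by (transfer, simp add: pres_eq.refl)+
  show "- a + a = 0" by transfer (rule pres_eq_inv_left)
  show "a + - b = a - b" by (simp add: minus_presented_def)
qed

end

lift_definition letter :: "bool \<Rightarrow> presented" is "\<lambda>s. [(s, True)]" .

definition gen_of :: "bool \<Rightarrow> real \<Rightarrow> real" where "gen_of s = (if s then gen_p else gen_q)"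

lemma gen_of_carrier: "gen_of s \<in> carrier Gamma_tilde"
  by (simp add: gen_of_def gens_carrier)

lemma word_eval_gens_relators: "r \<in> relators gen_p gen_q \<Longrightarrow> word_eval Gamma_tilde r = \<one>\<^bsub>Gamma_tilde\<^esub>"
  by (rule GT.word_eval_relators[OF gens_carrier]) (simp_all only: Gamma_tilde_mult gens_relation_1 gens_relation_2)

lift_definition presented_map :: "presented \<Rightarrow> real \<Rightarrow> real" is
  "\<lambda>w. word_eval Gamma_tilde (map (map_prod gen_of id) w)"
proof (rule GT.pres_eq_word_eval[OF _ gen_of_carrier])
  fix r assume "r \<in> relators True False"
  then have "map (map_prod gen_of id) r \<in> relators gen_p gen_q"
    using map_relators[of r True False gen_of] by (simp add: gen_of_def)
  then show "word_eval Gamma_tilde (map (map_prod gen_of id) r) = \<one>\<^bsub>Gamma_tilde\<^esub>"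
    by (rule word_eval_gens_relators)
qed

lemma uminus_letter: "- letter s = abs_presented [(s, False)]"
  by transfer (simp add: inv_word_def pres_eq.refl)

lemma presented_relation:
  assumes "u @ inv_word v \<in> relators True False"
  shows "abs_presented u = abs_presented v"
proof -
  have "abs_presented u + - abs_presented v = 0"
    using pres_eq.rel[OF assms] by (simp add: plus_presented.abs_eq uminus_presented.abs_eq zero_presented_def presented.abs_eq_iff)
  then show ?thesis by simp
qed

interpretation presented: two_generator_lift "letter True" "letter False" presented_map
proof
  have letters: "letter a = abs_presented [(a, True)]" for a by (simp add: letter.abs_eq)
  show "letter True + letter True + letter False + letter True + letter True = letter False + letter True + letter True + letter False"
    unfolding letters plus_presented.abs_eq by (rule presented_relation) (simp add: inv_word_def relators_def)
  show "letter True + letter False + letter False + letter True = letter False + letter False + letter True + letter False + letter False"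
    unfolding letters plus_presented.abs_eq by (rule presented_relation) (simp add: inv_word_def relators_def)
  show "presented_map 0 = id" by transfer simp
  have c: "set (map (map_prod gen_of id) w) \<subseteq> carrier Gamma_tilde \<times> UNIV" for w :: "(bool \<times> bool) list"
    using gen_of_carrier by auto
  show "presented_map (x + y) = presented_map x \<circ> presented_map y" for x y
    by transfer (simp only: map_append GT.word_eval_append[OF c c] Gamma_tilde_mult)
  show "presented_map (letter True) = gen_p" "presented_map (letter False) = gen_q"
    by (transfer, simp add: GT.word_eval_Cons gen_of_def)+
  show "x \<in> gen2 (letter True) (letter False)" for x
  proof (induction x rule: presented.abs_induct)
    case (1 w)
    show ?case
    proof (induction w)
      case Nil
      then show ?case using gen2.zero[of "letter True" "letter False"] by (simp add: zero_presented_def)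
    next
      case (Cons a w)
      obtain s b where a: "a = (s, b)" by fastforce
      have "abs_presented (a # w) = (if b then letter s else - letter s) + abs_presented w"
        unfolding a uminus_letter by (simp add: letters plus_presented.abs_eq)
      then show ?case using Cons gen2.intros(2-5)[OF Cons] by (cases s) (auto simp del: add_uminus_conv_diff)
    qed
  qed
qed

lemma Gamma_tilde_presentation:
  assumes w: "set w \<subseteq> {gen_p, gen_q} \<times> UNIV"
  shows "word_eval Gamma_tilde w = \<one>\<^bsub>Gamma_tilde\<^esub> \<longleftrightarrow> pres_eq (relators gen_p gen_q) w []"
proof
  define w' where "w' = map (map_prod (\<lambda>s. s = gen_p) id) w"
  have w': "map (map_prod gen_of id) w' = w"
    using w unfolding w'_def by (auto simp: gen_of_def intro!: map_idI)
  assume "word_eval Gamma_tilde w = \<one>\<^bsub>Gamma_tilde\<^esub>"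
  then have "presented_map (abs_presented w') = id" by (simp add: presented_map.abs_eq w')
  then have "abs_presented w' = 0" by (rule presented.kernel_trivial)
  then have "pres_eq (relators True False) w' []" by (simp add: zero_presented_def presented.abs_eq_iff)
  then have "pres_eq (relators gen_p gen_q) (map (map_prod gen_of id) w') (map (map_prod gen_of id) [])"
    by (rule pres_eq_map) (use map_relators[of _ True False gen_of] in \<open>simp add: gen_of_def\<close>)
  then show "pres_eq (relators gen_p gen_q) w []" by (simp add: w')
next
  assume pe: "pres_eq (relators gen_p gen_q) w []"
  \<comment> \<open>Foreign letters that a derivation may introduce are sent to
    \<open>gen_p\<close>, an arbitrary element of the carrier; \<open>w\<close> itself is
    unchanged.\<close>
  define \<sigma> where "\<sigma> = (\<lambda>s. if s \<in> {gen_p, gen_q} then s else gen_p)"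
  have c: "\<sigma> s \<in> carrier Gamma_tilde" for s using gens_carrier by (auto simp: \<sigma>_def)
  have "map (map_prod \<sigma> id) w = w" using w by (auto simp: \<sigma>_def intro!: map_idI)
  moreover have "word_eval Gamma_tilde (map (map_prod \<sigma> id) w) = word_eval Gamma_tilde (map (map_prod \<sigma> id) [])"
  proof (rule GT.pres_eq_word_eval[OF pe c])
    fix r assume "r \<in> relators gen_p gen_q"
    then have "map (map_prod \<sigma> id) r \<in> relators gen_p gen_q"
      using map_relators[of r gen_p gen_q \<sigma>] by (simp add: \<sigma>_def)
    then show "word_eval Gamma_tilde (map (map_prod \<sigma> id) r) = \<one>\<^bsub>Gamma_tilde\<^esub>" by (rule word_eval_gens_relators)
  qed
  ultimately show "word_eval Gamma_tilde w = \<one>\<^bsub>Gamma_tilde\<^esub>" by simp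
qed

lemma finitely_presented_Gamma_tilde: "finitely_presented Gamma_tilde"
  unfolding finitely_presented_def
proof (intro exI[of _ "{gen_p, gen_q}"] exI[of _ "relators gen_p gen_q"] conjI)
  show "\<forall>w. set w \<subseteq> {gen_p, gen_q} \<times> UNIV \<longrightarrow>
    (word_eval Gamma_tilde w = \<one>\<^bsub>Gamma_tilde\<^esub>) = pres_eq (relators gen_p gen_q) w []"
    using Gamma_tilde_presentation by blast
qed (auto simp: gens_carrier generate_Gamma_tilde relators_def)

section \<open>The first homology group\<close>

definition single :: "'b \<Rightarrow> 'm::zero \<Rightarrow> 'b \<Rightarrow> 'm" where
  "single x m = (\<lambda>y. if y = x then m else 0)"

lemma sum_fun_apply: "(\<Sum>i\<in>A. f i) x = (\<Sum>i\<in>A. f i x)" for f :: "'i \<Rightarrow> 'b \<Rightarrow> 'm::comm_monoid_add"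
  by (induction A rule: infinite_finite_induct) auto

lemma chain_eq_sum_single:
  assumes "finite {x. c x \<noteq> 0}"
  shows "c = (\<Sum>x\<in>{x. c x \<noteq> 0}. single x (c x))"
proof
  fix y
  have "(\<Sum>x\<in>{x. c x \<noteq> 0}. single x (c x)) y = (\<Sum>x\<in>{x. c x \<noteq> 0}. if y = x then c x else 0)"
    by (simp add: sum_fun_apply single_def)
  also have "\<dots> = c y" using assms by (simp add: sum.delta)
  finally show "c y = (\<Sum>x\<in>{x. c x \<noteq> 0}. single x (c x)) y" by simp
qed

text \<open>An index set larger than the support allows chains with different supports to be summed
  over one common finite set.\<close>

lemma bar_boundary_eq_sum:
  assumes "finite A" "{xs. c xs \<noteq> 0} \<subseteq> A"
  shows "bar_boundary G c ys = (\<Sum>xs\<in>A. \<Sum>i\<in>{0..length xs}.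
      if bar_face G i xs = ys then (if even i then c xs else - c xs) else 0)"
  unfolding bar_boundary_def using assms
  by (intro sum.mono_neutral_left) (auto intro!: sum.neutral split: if_splits)

lemma single_chain: "length xs = n \<Longrightarrow> set xs \<subseteq> carrier G \<Longrightarrow> single xs m \<in> bar_chains G n"
  by (auto simp: bar_chains_def single_def intro: finite_subset[of _ "{xs}"])

lemma bar_boundary_single:
  "bar_boundary G (single xs m) ys =
    (\<Sum>i\<in>{0..length xs}. if bar_face G i xs = ys then (if even i then m else - m) else 0)"
  by (subst bar_boundary_eq_sum[where A="{xs}"]) (auto simp: single_def cong: if_cong)

lemma bar_chains_add:
  assumes "c \<in> bar_chains G n" "d \<in> bar_chains G n" shows "c + d \<in> bar_chains G n"
proof -
  have sub: "{xs. (c + d) xs \<noteq> 0} \<subseteq> {xs. c xs \<noteq> 0} \<union> {xs. d xs \<noteq> 0}" by auto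
  have "finite {xs. (c + d) xs \<noteq> 0}"
    by (rule finite_subset[OF sub]) (use assms in \<open>simp add: bar_chains_def\<close>)
  moreover have "length xs = n \<and> set xs \<subseteq> carrier G" if "(c + d) xs \<noteq> 0" for xs
  proof -
    have "c xs \<noteq> 0 \<or> d xs \<noteq> 0" using sub that by blast
    then show ?thesis using assms by (auto simp: bar_chains_def)
  qed
  ultimately show ?thesis by (simp add: bar_chains_def)
qed

lemma bar_chains_scale:
  fixes c :: "'a list \<Rightarrow> 'm::comm_ring_1"
  assumes "c \<in> bar_chains G n" shows "(\<lambda>xs. r * c xs) \<in> bar_chains G n"
proof -
  have "{xs. r * c xs \<noteq> 0} \<subseteq> {xs. c xs \<noteq> 0}" by auto
  then show ?thesis using assms unfolding bar_chains_def
    by (auto intro: finite_subset)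
qed

lemma bar_boundary_add:
  assumes "c \<in> bar_chains G n" "d \<in> bar_chains G n"
  shows "bar_boundary G (c + d) = bar_boundary G c + bar_boundary G d"
proof
  fix ys
  let ?A = "{xs. c xs \<noteq> 0} \<union> {xs. d xs \<noteq> 0}"
  have A: "finite ?A" "{xs. c xs \<noteq> 0} \<subseteq> ?A" "{xs. d xs \<noteq> 0} \<subseteq> ?A" "{xs. (c + d) xs \<noteq> 0} \<subseteq> ?A"
    using assms by (auto simp: bar_chains_def)
  show "bar_boundary G (c + d) ys = (bar_boundary G c + bar_boundary G d) ys"
    unfolding plus_fun_apply bar_boundary_eq_sum[OF A(1,2)] bar_boundary_eq_sum[OF A(1,3)] bar_boundary_eq_sum[OF A(1,4)]
      sum.distrib[symmetric]
    by (intro sum.cong) auto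
qed

lemma bar_boundary_scale:
  fixes c :: "'a list \<Rightarrow> 'm::comm_ring_1"
  assumes "c \<in> bar_chains G n"
  shows "bar_boundary G (\<lambda>xs. r * c xs) = (\<lambda>ys. r * bar_boundary G c ys)"
proof
  fix ys
  let ?A = "{xs. c xs \<noteq> 0}"
  have A: "finite ?A" "{xs. r * c xs \<noteq> 0} \<subseteq> ?A" using assms by (auto simp: bar_chains_def)
  show "bar_boundary G (\<lambda>xs. r * c xs) ys = r * bar_boundary G c ys"
    unfolding bar_boundary_eq_sum[OF A] bar_boundary_eq_sum[OF A(1) order.refl] sum_distrib_left
    by (intro sum.cong) auto
qed

lemma bar_boundaries_add:
  "b \<in> bar_boundaries G n \<Longrightarrow> b' \<in> bar_boundaries G n \<Longrightarrow> b + b' \<in> bar_boundaries G n"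
proof -
  assume "b \<in> bar_boundaries G n" "b' \<in> bar_boundaries G n"
  then obtain c c' where "c \<in> bar_chains G (Suc n)" "c' \<in> bar_chains G (Suc n)" "b = bar_boundary G c" "b' = bar_boundary G c'"
    by (auto simp: bar_boundaries_def)
  then show ?thesis unfolding bar_boundaries_def
    by (intro image_eqI[of _ _ "c + c'"]) (simp_all only: bar_chains_add bar_boundary_add)
qed

lemma bar_boundaries_scale:
  fixes b :: "'a list \<Rightarrow> 'm::comm_ring_1"
  shows "b \<in> bar_boundaries G n \<Longrightarrow> (\<lambda>xs. r * b xs) \<in> bar_boundaries G n"
proof -
  assume "b \<in> bar_boundaries G n"
  then obtain c where "c \<in> bar_chains G (Suc n)" "b = bar_boundary G c" by (auto simp: bar_boundaries_def)
  then show ?thesis unfolding bar_boundaries_def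
    by (intro image_eqI[of _ _ "\<lambda>xs. r * c xs"]) (simp_all only: bar_chains_scale bar_boundary_scale)
qed

lemma bar_boundaries_zero: "0 \<in> bar_boundaries G n"
proof -
  have "0 \<in> bar_chains G (Suc n)" by (auto simp: bar_chains_def)
  moreover have "bar_boundary G 0 = 0" by (auto simp: bar_boundary_def)
  ultimately show ?thesis unfolding bar_boundaries_def by force
qed

lemma bar_boundaries_uminus:
  fixes b :: "'a list \<Rightarrow> 'm::comm_ring_1"
  assumes "b \<in> bar_boundaries G n" shows "- b \<in> bar_boundaries G n"
proof -
  have "- b = (\<lambda>xs. - 1 * b xs)" by auto
  then show ?thesis using bar_boundaries_scale[OF assms, of "-1"] by (simp only:)
qed

lemma bar_boundaries_diff:
  fixes b :: "'a list \<Rightarrow> 'm::comm_ring_1"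
  assumes "b \<in> bar_boundaries G n" "b' \<in> bar_boundaries G n" shows "b - b' \<in> bar_boundaries G n"
  using bar_boundaries_add[OF assms(1) bar_boundaries_uminus[OF assms(2)]] by simp

lemma bar_boundaries_sum:
  assumes "\<And>i. i \<in> A \<Longrightarrow> b i \<in> bar_boundaries G n" shows "(\<Sum>i\<in>A. b i) \<in> bar_boundaries G n"
  using assms by (induction A rule: infinite_finite_induct) (auto intro: bar_boundaries_zero bar_boundaries_add)

context group begin

text \<open>Modulo boundaries the map g |-> [g] is thus additive, which is how relations of the
  group enter its first homology.\<close>

lemma boundary_two_simplex:
  assumes "g \<in> carrier G" "h \<in> carrier G"
  shows "single [h] m - single [g \<otimes> h] m + single [g] m \<in> (bar_boundaries G 1 :: ('a list \<Rightarrow> 'm::ab_group_add) set)"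
proof -
  have c: "single [g, h] m \<in> bar_chains G (Suc 1)" using assms by (intro single_chain) auto
  have b: "bar_boundary G (single [g, h] m) = single [h] m - single [g \<otimes> h] m + single [g] m"
  proof
    fix ys
    have "{0..length [g, h]} = {0, 1, 2}" by auto
    moreover have "bar_face G 0 [g, h] = [h]" "bar_face G 1 [g, h] = [g \<otimes> h]" "bar_face G 2 [g, h] = [g]"
      by (simp_all add: bar_face_def)
    ultimately show "bar_boundary G (single [g, h] m) ys = (single [h] m - single [g \<otimes> h] m + single [g] m) ys"
      unfolding bar_boundary_single by (simp add: single_def)
  qed
  show ?thesis unfolding bar_boundaries_def using imageI[OF c, of "bar_boundary G"] unfolding b .
qed

lemma boundary_three_simplex:
  assumes "g \<in> carrier G" "h \<in> carrier G" "k \<in> carrier G"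
  shows "single [h, k] m - single [g \<otimes> h, k] m + single [g, h \<otimes> k] m - single [g, h] m
    \<in> (bar_boundaries G 2 :: ('a list \<Rightarrow> 'm::ab_group_add) set)"
proof -
  have c: "single [g, h, k] m \<in> bar_chains G (Suc 2)" using assms by (intro single_chain) auto
  have b: "bar_boundary G (single [g, h, k] m) =
    single [h, k] m - single [g \<otimes> h, k] m + single [g, h \<otimes> k] m - single [g, h] m"
  proof
    fix ys
    have "{0..length [g, h, k]} = {0, 1, 2, 3}" by auto
    moreover have "bar_face G 0 [g, h, k] = [h, k]" "bar_face G 1 [g, h, k] = [g \<otimes> h, k]"
      "bar_face G 2 [g, h, k] = [g, h \<otimes> k]" "bar_face G 3 [g, h, k] = [g, h]"
      by (simp_all add: bar_face_def)
    ultimately show "bar_boundary G (single [g, h, k] m) ys =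
      (single [h, k] m - single [g \<otimes> h, k] m + single [g, h \<otimes> k] m - single [g, h] m) ys"
      unfolding bar_boundary_single by (simp add: single_def)
  qed
  show ?thesis unfolding bar_boundaries_def using imageI[OF c, of "bar_boundary G"] unfolding b .
qed

text \<open>Both faces of a one-simplex are the empty list, and they occur with opposite
  signs.\<close>

lemma bar_cycles_1: "bar_cycles G 1 = (bar_chains G 1 :: ('a list \<Rightarrow> 'm::ab_group_add) set)"
proof -
  have "bar_boundary G c = (\<lambda>_. 0)" if c: "c \<in> bar_chains G 1" for c :: "'a list \<Rightarrow> 'm"
  proof
    fix ys
    have "(\<Sum>i\<in>{0..length xs}. if bar_face G i xs = ys then (if even i then c xs else - c xs) else 0) = 0"
      if "c xs \<noteq> 0" for xs
    proof -
      have "length xs = 1" using c that by (auto simp: bar_chains_def)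
      then obtain g where "xs = [g]" by (auto simp: length_Suc_conv)
      moreover have "{0..length [g]} = {0, 1}" by auto
      ultimately show ?thesis by (auto simp: bar_face_def)
    qed
    then show "bar_boundary G c ys = 0" unfolding bar_boundary_def by (intro sum.neutral) auto
  qed
  then show ?thesis by (auto simp: bar_cycles_def)
qed

text \<open>The abelianised relators show that [q] is 2[p] and that 3[p] vanishes, so every class is
  one of 0, [p], 2[p].\<close>

lemma finite_H1_of_relations:
  assumes pq: "p \<in> carrier G" "q \<in> carrier G"
    and gen: "generate G {p, q} = carrier G"
    and r1: "p \<otimes> p \<otimes> q \<otimes> p \<otimes> p = q \<otimes> p \<otimes> p \<otimes> q"
    and r2: "p \<otimes> q \<otimes> q \<otimes> p = q \<otimes> q \<otimes> p \<otimes> q \<otimes> q"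
  shows "finite (group_homology G 1 :: ('a list \<Rightarrow> int) set set)"
proof -
  let ?B = "bar_boundaries G 1 :: ('a list \<Rightarrow> int) set"
  note closed = bar_boundaries_add[where n=1 and G=G] bar_boundaries_diff[where n=1 and G=G]
  define D where "D g = single [g] (1::int)" for g :: 'a
  have D_mult: "D (g \<otimes> h) - (X + Y) \<in> ?B"
    if "g \<in> carrier G" "h \<in> carrier G" "D g - X \<in> ?B" "D h - Y \<in> ?B" for g h X Y
  proof -
    have "(D g - X) + (D h - Y) - (D h - D (g \<otimes> h) + D g) \<in> ?B"
      by (rule closed(2)[OF closed(1)[OF that(3,4)] boundary_two_simplex[OF that(1,2), where m="1::int", folded D_def]])
    then show ?thesis by (simp add: algebra_simps)
  qed
  have D_refl: "D g - D g \<in> ?B" for g using bar_boundaries_zero by simp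
  have "D (p \<otimes> p \<otimes> q \<otimes> p \<otimes> p) - (D p + D p + D q + D p + D p) \<in> ?B"
    "D (q \<otimes> p \<otimes> p \<otimes> q) - (D q + D p + D p + D q) \<in> ?B"
    "D (p \<otimes> q \<otimes> q \<otimes> p) - (D p + D q + D q + D p) \<in> ?B"
    "D (q \<otimes> q \<otimes> p \<otimes> q \<otimes> q) - (D q + D q + D p + D q + D q) \<in> ?B"
    by (intro D_mult D_refl m_closed pq)+
  note R = closed(2)[OF this(2)[folded r1] this(1)] closed(2)[OF this(4)[folded r2] this(3)]
  have e1: "D p + D p - D q \<in> ?B" using R(1) by (simp add: algebra_simps)
  have e2: "D p - (D q + D q) \<in> ?B" using R(2) bar_boundaries_uminus[of _ G 1] by (fastforce simp: algebra_simps)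
  \<comment> \<open>3p = 2(2p - q) - (p - 2q).\<close>
  have e3: "D p + D p + D p \<in> ?B" using closed(2)[OF closed(1)[OF e1 e1] e2] by (simp add: algebra_simps)
  have single_add: "single x m + single x n = single x (m + n)" "single x m - single x n = single x (m - n)"
    for x :: "'a list" and m n :: int by (auto simp: single_def)
  have three: "single [p] (3 * m) \<in> ?B" for m
    using bar_boundaries_scale[OF e3, of m] by (simp add: D_def single_add) (simp add: single_def if_distrib[of "(*) m"] mult.commute cong: if_cong)
  have ex_gen: "\<exists>k. D h - single [p] k \<in> ?B" if "h \<in> {p, q}" for h
  proof (cases "h = p")
    case True
    then show ?thesis using D_refl[of p] unfolding D_def by blast
  next
    case False
    then have "D h - single [p] 2 = - (D p + D p - D q)" using that by (auto simp: D_def single_def)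
    then show ?thesis using bar_boundaries_uminus[OF e1] by metis
  qed
  have "\<exists>k. D g - single [p] k \<in> ?B" if "g \<in> carrier G" for g
    using that unfolding gen[symmetric]
  proof induction
    case one
    \<comment> \<open>The degenerate simplex [1|1] has boundary [1] - [1] + [1], so the class of the
      neutral element is zero.\<close>
    have "D \<one> - single [p] 0 = D \<one> - D (\<one> \<otimes> \<one>) + D \<one>" by (auto simp: single_def)
    then show ?case using boundary_two_simplex[of \<one> \<one> "1::int"] by (metis D_def one_closed)
  next
    case (incl h)
    then show ?case by (rule ex_gen)
  next
    case (inv h)
    have h: "h \<in> carrier G" using inv pq by auto
    obtain k where k: "D h - single [p] k \<in> ?B" using ex_gen[OF inv] by blast
    have 1: "D (inv h) - D \<one> + D h \<in> ?B" using boundary_two_simplex[OF h inv_closed[OF h], of "1::int"] h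
      by (simp add: D_def algebra_simps)
    have 2: "D \<one> - D \<one> + D \<one> \<in> ?B" using boundary_two_simplex[of \<one> \<one> "1::int"] by (simp add: D_def)
    have "D (inv h) - single [p] (- k) = (D (inv h) - D \<one> + D h) + (D \<one> - D \<one> + D \<one>) - (D h - single [p] k)"
      by (auto simp: single_def)
    then show ?case using closed(2)[OF closed(1)[OF 1 2] k] by metis
  next
    case (eng g h)
    then obtain k l where "D g - single [p] k \<in> ?B" "D h - single [p] l \<in> ?B" by blast
    then have "D (g \<otimes> h) - (single [p] k + single [p] l) \<in> ?B" using eng.hyps gen by (intro D_mult) auto
    then show ?case unfolding single_add by blast
  qed
  then obtain k where k: "\<And>g. g \<in> carrier G \<Longrightarrow> D g - single [p] (k g) \<in> ?B" by metis
  have rep: "\<exists>m\<in>{0..<3}. c - single [p] m \<in> ?B" if c: "c \<in> bar_chains G 1" for c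
  proof -
    let ?S = "{xs. c xs \<noteq> 0}"
    define N where "N = (\<Sum>xs\<in>?S. c xs * k (hd xs))"
    have fin: "finite ?S" using c by (simp add: bar_chains_def)
    have "single xs (c xs) - single [p] (c xs * k (hd xs)) \<in> ?B" if "xs \<in> ?S" for xs
    proof -
      have "length xs = 1" "set xs \<subseteq> carrier G" using c that by (auto simp: bar_chains_def)
      then obtain g where g: "xs = [g]" "g \<in> carrier G" by (auto simp: length_Suc_conv)
      have "(\<lambda>ys. c xs * (D g - single [p] (k g)) ys) = single xs (c xs) - single [p] (c xs * k (hd xs))"
        by (auto simp: fun_eq_iff g(1) D_def single_def algebra_simps)
      then show ?thesis using bar_boundaries_scale[OF k[OF g(2)], of "c xs"] by simp
    qed
    then have "(\<Sum>xs\<in>?S. single xs (c xs) - single [p] (c xs * k (hd xs))) \<in> ?B" by (rule bar_boundaries_sum)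
    moreover have "(\<Sum>xs\<in>?S. single [p] (c xs * k (hd xs))) = single [p] N"
      by (auto simp: fun_eq_iff sum_fun_apply single_def N_def)
    ultimately have cN: "c - single [p] N \<in> ?B"
      by (simp only: sum_subtractf chain_eq_sum_single[OF fin, symmetric])
    have "c - single [p] (N mod 3) = (c - single [p] N) + single [p] (3 * (N div 3))"
      using minus_mult_div_eq_mod[of N 3] by (auto simp: single_def fun_eq_iff)
    then have "c - single [p] (N mod 3) \<in> ?B" using closed(1)[OF cN three] by metis
    then show ?thesis by (intro bexI[of _ "N mod 3"]) auto
  qed
  let ?r = "{(c, d). c \<in> bar_cycles G 1 \<and> d \<in> bar_cycles G 1 \<and> c - d \<in> ?B}"
  have "group_homology G 1 \<subseteq> (\<lambda>m. ?r `` {single [p] m}) ` {0..<3::int}"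
  proof
    fix X assume "X \<in> (group_homology G 1 :: ('a list \<Rightarrow> int) set set)"
    then obtain c where c: "c \<in> bar_cycles G 1" "X = ?r `` {c}"
      unfolding group_homology_def by (auto elim!: quotientE)
    obtain m where m: "m \<in> {0..<3}" "c - single [p] m \<in> ?B" using rep c(1) bar_cycles_1 by metis
    have s: "single [p] m \<in> bar_cycles G 1" unfolding bar_cycles_1 using pq by (intro single_chain) auto
    have "c - d \<in> ?B \<longleftrightarrow> single [p] m - d \<in> ?B" for d
    proof
      assume "c - d \<in> ?B" then show "single [p] m - d \<in> ?B"
        using closed(2)[OF _ m(2), of "c - d"] by simp
    next
      assume "single [p] m - d \<in> ?B" then show "c - d \<in> ?B"
        using closed(1)[OF _ m(2), of "single [p] m - d"] by simp
    qed
    then have "X = ?r `` {single [p] m}" using c s by auto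
    then show "X \<in> (\<lambda>m. ?r `` {single [p] m}) ` {0..<3::int}" using m(1) by blast
  qed
  then show ?thesis by (rule finite_subset) auto
qed

end

section \<open>The second homology group\<close>

definition is_cocycle :: "('a, 'b) monoid_scheme \<Rightarrow> ('a \<Rightarrow> 'a \<Rightarrow> real) \<Rightarrow> bool" where
  "is_cocycle G f \<longleftrightarrow> (\<forall>g\<in>carrier G. \<forall>h\<in>carrier G. \<forall>k\<in>carrier G.
     f h k - f (g \<otimes>\<^bsub>G\<^esub> h) k + f g (h \<otimes>\<^bsub>G\<^esub> k) - f g h = 0)"

text \<open>The cocycle is not assumed normalised, hence the correction in the neutral element; it
  works because the cocycle identity makes \<open>f \<one> k\<close> independent of
  \<open>k\<close>.\<close>

definition central_ext :: "('a, 'b) monoid_scheme \<Rightarrow> ('a \<Rightarrow> 'a \<Rightarrow> real) \<Rightarrow> ('a \<times> real) monoid" where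
  "central_ext G f = \<lparr> carrier = carrier G \<times> UNIV,
     monoid.mult = (\<lambda>(g, x) (h, y). (g \<otimes>\<^bsub>G\<^esub> h, x + y + f g h)), one = (\<one>\<^bsub>G\<^esub>, - f \<one>\<^bsub>G\<^esub> \<one>\<^bsub>G\<^esub>) \<rparr>"

lemma central_ext_simps [simp]:
  "carrier (central_ext G f) = carrier G \<times> UNIV"
  "(g, x) \<otimes>\<^bsub>central_ext G f\<^esub> (h, y) = (g \<otimes>\<^bsub>G\<^esub> h, x + y + f g h)"
  "\<one>\<^bsub>central_ext G f\<^esub> = (\<one>\<^bsub>G\<^esub>, - f \<one>\<^bsub>G\<^esub> \<one>\<^bsub>G\<^esub>)"
  by (simp_all add: central_ext_def)

context group begin

lemma group_central_ext:
  assumes f: "is_cocycle G f" shows "group (central_ext G f)"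
proof (rule groupI)
  have coc: "f h k - f (g \<otimes> h) k + f g (h \<otimes> k) - f g h = 0"
    if "g \<in> carrier G" "h \<in> carrier G" "k \<in> carrier G" for g h k
    using f that by (simp add: is_cocycle_def)
  have f1: "f \<one> k = f \<one> \<one>" if "k \<in> carrier G" for k
    using coc[of \<one> \<one> k] that by simp
  fix a assume a: "a \<in> carrier (central_ext G f)"
  then obtain g x where gx: "a = (g, x)" "g \<in> carrier G" by auto
  show "\<one>\<^bsub>central_ext G f\<^esub> \<otimes>\<^bsub>central_ext G f\<^esub> a = a"
    using gx f1[OF gx(2)] by simp
  show "\<exists>b\<in>carrier (central_ext G f). b \<otimes>\<^bsub>central_ext G f\<^esub> a = \<one>\<^bsub>central_ext G f\<^esub>"
    using gx by (intro bexI[of _ "(inv g, - x - f (inv g) g - f \<one> \<one>)"]) auto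
  fix b c assume bc: "b \<in> carrier (central_ext G f)" "c \<in> carrier (central_ext G f)"
  then obtain h y k z where "b = (h, y)" "h \<in> carrier G" "c = (k, z)" "k \<in> carrier G" by auto
  then show "a \<otimes>\<^bsub>central_ext G f\<^esub> b \<otimes>\<^bsub>central_ext G f\<^esub> c = a \<otimes>\<^bsub>central_ext G f\<^esub> (b \<otimes>\<^bsub>central_ext G f\<^esub> c)"
    using gx coc[of g h k] by (simp add: m_assoc)
qed auto

lemma word_eval_inv_word:
  "set w \<subseteq> carrier G \<times> UNIV \<Longrightarrow> word_eval G (inv_word w) = inv (word_eval G w)"
proof (induction w)
  case Nil then show ?case by (simp add: inv_word_def)
next
  case (Cons a w)
  obtain s b where a: "a = (s, b)" by fastforce
  have s: "s \<in> carrier G" and w: "set w \<subseteq> carrier G \<times> UNIV" using Cons.prems a by auto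
  then have iw: "set (inv_word w) \<subseteq> carrier G \<times> UNIV" by (fastforce simp: inv_word_def)
  have "word_eval G (inv_word (a # w)) = word_eval G (inv_word w @ [(s, \<not> b)])" by (simp add: a inv_word_def)
  also have "\<dots> = word_eval G (inv_word w) \<otimes> word_eval G [(s, \<not> b)]"
    using iw s by (intro word_eval_append) auto
  also have "\<dots> = inv (word_eval G (a # w))"
    using Cons.IH[OF w] s word_eval_closed[OF w] by (auto simp: a word_eval_Cons inv_mult_group)
  finally show ?case .
qed

text \<open>Lifts of \<open>p\<close> and \<open>q\<close> that satisfy the relators make the value
  of a word in the extension depend only on its value in the group. This gives a homomorphic section
  g |-> (g, \<beta> g), and comparing second coordinates exhibits \<open>f\<close> as the coboundary
  of -\<beta>.\<close>

lemma cocycle_splits: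
  assumes pq: "p \<in> carrier G" "q \<in> carrier G" "p \<noteq> q"
    and gen: "generate G {p, q} = carrier G"
    and r1: "p \<otimes> p \<otimes> q \<otimes> p \<otimes> p = q \<otimes> p \<otimes> p \<otimes> q"
    and r2: "p \<otimes> q \<otimes> q \<otimes> p = q \<otimes> q \<otimes> p \<otimes> q \<otimes> q"
    and pres: "\<And>w. set w \<subseteq> {p, q} \<times> UNIV \<Longrightarrow> word_eval G w = \<one> \<Longrightarrow> pres_eq (relators p q) w []"
    and f: "is_cocycle G f"
  shows "\<exists>b. \<forall>g\<in>carrier G. \<forall>h\<in>carrier G. f g h = b g + b h - b (g \<otimes> h)"
proof -
  let ?E = "central_ext G f"
  interpret E: group ?E by (rule group_central_ext[OF f])
  \<comment> \<open>The cocycle terms that accumulate when the four sides of the relations are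
    multiplied out from the left.\<close>
  define K1 K2 K3 K4 where "K1 = f p p + f (p \<otimes> p) q + f (p \<otimes> p \<otimes> q) p + f (p \<otimes> p \<otimes> q \<otimes> p) p"
    and "K2 = f q p + f (q \<otimes> p) p + f (q \<otimes> p \<otimes> p) q"
    and "K3 = f p q + f (p \<otimes> q) q + f (p \<otimes> q \<otimes> q) p"
    and "K4 = f q q + f (q \<otimes> q) p + f (q \<otimes> q \<otimes> p) q + f (q \<otimes> q \<otimes> p \<otimes> q) q"
  \<comment> \<open>The solution of 2x - y = K2 - K1 and x - 2y = K4 - K3, which say that the lifts
    satisfy the relations. The determinant -3 accounts for the division by 3.\<close>
  define x y where "x = (2 * (K2 - K1) - (K4 - K3)) / 3" and "y = ((K2 - K1) - 2 * (K4 - K3)) / 3"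
  have xy: "4 * x + y + K1 = 2 * x + 2 * y + K2" "2 * x + 2 * y + K3 = x + 4 * y + K4"
    by (simp_all add: x_def y_def field_simps)
  \<comment> \<open>Any value in the carrier would do for letters other than \<open>p\<close> and
    \<open>q\<close>; \<open>E.pres_eq_word_eval\<close> asks for a total substitution.\<close>
  define \<sigma> where "\<sigma> s = (if s = p then (p, x) else if s = q then (q, y) else \<one>\<^bsub>?E\<^esub>)" for s
  have \<sigma>pq: "\<sigma> p = (p, x)" "\<sigma> q = (q, y)" using pq by (auto simp: \<sigma>_def)
  have \<sigma>c: "\<sigma> s \<in> carrier ?E" for s using pq by (auto simp: \<sigma>_def)
  define ev where "ev w = word_eval ?E (map (map_prod \<sigma> id) w)" for w
  have wc: "set (map (map_prod \<sigma> id) w) \<subseteq> carrier ?E \<times> UNIV" for w :: "('a \<times> bool) list"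
    using \<sigma>c by (auto simp del: central_ext_simps)
  have ev_append: "ev (v @ w) = ev v \<otimes>\<^bsub>?E\<^esub> ev w" for v w
    unfolding ev_def map_append by (rule E.word_eval_append[OF wc wc])
  have ev_inv: "ev (inv_word w) = inv\<^bsub>?E\<^esub> ev w" for w
    using E.word_eval_inv_word[OF wc, of w] by (simp add: ev_def inv_word_def rev_map comp_def case_prod_beta map_prod_def)
  have ev_closed: "ev w \<in> carrier ?E" for w unfolding ev_def by (rule E.word_eval_closed[OF wc])
  have fst_inv: "fst (inv\<^bsub>?E\<^esub> a) = inv (fst a)" if "a \<in> carrier ?E" for a
  proof -
    have "inv\<^bsub>?E\<^esub> a \<in> carrier ?E" "inv\<^bsub>?E\<^esub> a \<otimes>\<^bsub>?E\<^esub> a = \<one>\<^bsub>?E\<^esub>"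
      using that E.inv_closed E.l_inv by blast+
    then show ?thesis using that
      by (cases a; cases "inv\<^bsub>?E\<^esub> a") (auto intro!: inv_equality[symmetric])
  qed
  have fst_ev: "fst (ev w) = word_eval G w" if "set w \<subseteq> {p, q} \<times> UNIV" for w
    using that
  proof (induction w)
    case Nil show ?case by (simp add: ev_def)
  next
    case (Cons a w)
    obtain s b where a: "a = (s, b)" by fastforce
    have s: "s \<in> {p, q}" and IH: "fst (ev w) = word_eval G w" using Cons a by auto
    have fs: "fst (\<sigma> s) = s" using s \<sigma>pq by auto
    have "ev (a # w) = (if b then \<sigma> s else inv\<^bsub>?E\<^esub> \<sigma> s) \<otimes>\<^bsub>?E\<^esub> ev w"
      by (simp add: ev_def a E.word_eval_Cons)
    moreover have "fst (c \<otimes>\<^bsub>?E\<^esub> d) = fst c \<otimes> fst d" for c d by (cases c; cases d) simp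
    ultimately show ?case using IH fs fst_inv[OF \<sigma>c[of s]] by (simp add: a word_eval_Cons)
  qed
  have rels: "word_eval ?E (map (map_prod \<sigma> id) r) = \<one>\<^bsub>?E\<^esub>" if "r \<in> relators p q" for r
  proof (rule E.word_eval_relators[of "(p, x)" "(q, y)"])
    show "map (map_prod \<sigma> id) r \<in> relators (p, x) (q, y)"
      using map_relators[OF that, of \<sigma>] by (simp add: \<sigma>pq)
    show "(p, x) \<otimes>\<^bsub>?E\<^esub> (p, x) \<otimes>\<^bsub>?E\<^esub> (q, y) \<otimes>\<^bsub>?E\<^esub> (p, x) \<otimes>\<^bsub>?E\<^esub> (p, x) =
          (q, y) \<otimes>\<^bsub>?E\<^esub> (p, x) \<otimes>\<^bsub>?E\<^esub> (p, x) \<otimes>\<^bsub>?E\<^esub> (q, y)"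
      using xy(1) r1 by (simp add: K1_def K2_def)
    show "(p, x) \<otimes>\<^bsub>?E\<^esub> (q, y) \<otimes>\<^bsub>?E\<^esub> (q, y) \<otimes>\<^bsub>?E\<^esub> (p, x) =
          (q, y) \<otimes>\<^bsub>?E\<^esub> (q, y) \<otimes>\<^bsub>?E\<^esub> (p, x) \<otimes>\<^bsub>?E\<^esub> (q, y) \<otimes>\<^bsub>?E\<^esub> (q, y)"
      using xy(2) r2 by (simp add: K3_def K4_def)
  qed (use pq in auto)
  have ev_one: "ev w = \<one>\<^bsub>?E\<^esub>" if "set w \<subseteq> {p, q} \<times> UNIV" "word_eval G w = \<one>" for w
    using E.pres_eq_word_eval[OF pres[OF that] \<sigma>c rels] by (simp add: ev_def)
  have "\<exists>w. set w \<subseteq> {p, q} \<times> UNIV \<and> word_eval G w = g" if "g \<in> carrier G" for g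
    using word_eval_surj[of "{p, q}" g] pq that gen by blast
  then obtain W where W: "\<And>g. g \<in> carrier G \<Longrightarrow> set (W g) \<subseteq> {p, q} \<times> UNIV"
    "\<And>g. g \<in> carrier G \<Longrightarrow> word_eval G (W g) = g" by metis
  define \<beta> where "\<beta> g = snd (ev (W g))" for g
  have evW: "ev (W g) = (g, \<beta> g)" if "g \<in> carrier G" for g
    using fst_ev[OF W(1)[OF that]] W(2)[OF that] by (simp add: \<beta>_def prod_eq_iff)
  have "f g h = - \<beta> g + - \<beta> h - - \<beta> (g \<otimes> h)" if gh: "g \<in> carrier G" "h \<in> carrier G" for g h
  proof -
    \<comment> \<open>This word represents the neutral element, so it is a consequence of the
      relators and also evaluates trivially in the extension.\<close>
    let ?w = "W g @ W h @ inv_word (W (g \<otimes> h))"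
    have ghc: "g \<otimes> h \<in> carrier G" using gh by simp
    have setinv: "set (inv_word w) \<subseteq> {p, q} \<times> UNIV" if "set w \<subseteq> {p, q} \<times> UNIV" for w :: "('a \<times> bool) list"
      using that by (fastforce simp: inv_word_def)
    have s: "set ?w \<subseteq> {p, q} \<times> UNIV" using W(1)[OF gh(1)] W(1)[OF gh(2)] setinv[OF W(1)[OF ghc]] by auto
    have c: "set (W k) \<subseteq> carrier G \<times> UNIV" if "k \<in> carrier G" for k using W(1)[OF that] pq by auto
    have c': "set (inv_word (W (g \<otimes> h))) \<subseteq> carrier G \<times> UNIV" using setinv[OF W(1)[OF ghc]] pq by auto
    have "word_eval G ?w = g \<otimes> (h \<otimes> inv (g \<otimes> h))"
      using c[OF gh(1)] c[OF gh(2)] c' W(2)[OF gh(1)] W(2)[OF gh(2)] W(2)[OF ghc] word_eval_inv_word[OF c[OF ghc]]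
      by (simp add: word_eval_append)
    also have "\<dots> = \<one>" using gh by (simp flip: m_assoc)
    finally have "ev ?w = \<one>\<^bsub>?E\<^esub>" by (rule ev_one[OF s])
    then have "(ev (W g) \<otimes>\<^bsub>?E\<^esub> ev (W h)) \<otimes>\<^bsub>?E\<^esub> inv\<^bsub>?E\<^esub> ev (W (g \<otimes> h)) = \<one>\<^bsub>?E\<^esub>"
      unfolding ev_append ev_inv using E.m_assoc[OF ev_closed ev_closed E.inv_closed[OF ev_closed]] by simp
    then have "ev (W g) \<otimes>\<^bsub>?E\<^esub> ev (W h) = ev (W (g \<otimes> h))"
      using E.inv_equality[of "ev (W g) \<otimes>\<^bsub>?E\<^esub> ev (W h)" "inv\<^bsub>?E\<^esub> ev (W (g \<otimes> h))"]
        E.m_closed[OF ev_closed ev_closed] E.inv_closed[OF ev_closed] E.inv_inv[OF ev_closed] by metis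
    then show ?thesis unfolding evW[OF gh(1)] evW[OF gh(2)] evW[OF ghc] by simp
  qed
  then show ?thesis by (intro exI[of _ "\<lambda>g. - \<beta> g"]) blast
qed

end

text \<open>A basis of \<open>B\<close> stays independent when \<open>c\<close> is adjoined, so a
  functional may be prescribed as 0 on the basis and 1 at \<open>c\<close>, then extended to the
  whole function space.\<close>

lemma separating_functional:
  fixes B :: "('b \<Rightarrow> real) set"
  assumes zero: "0 \<in> B" and add: "\<And>b b'. b \<in> B \<Longrightarrow> b' \<in> B \<Longrightarrow> b + b' \<in> B"
    and scale: "\<And>r b. b \<in> B \<Longrightarrow> (\<lambda>x. r * b x) \<in> B" and c: "c \<notin> B"
  obtains F :: "('b \<Rightarrow> real) \<Rightarrow> real" where "\<And>x y. F (x + y) = F x + F y" "\<And>r x. F (\<lambda>i. r * x i) = r * F x"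
    "\<And>b. b \<in> B \<Longrightarrow> F b = 0" "F c \<noteq> 0"
proof -
  define sc where "sc = (\<lambda>(r::real) (x :: 'b \<Rightarrow> real) i. r * x i)"
  interpret V: vector_space sc by unfold_locales (auto simp: sc_def algebra_simps)
  interpret R: vector_space "(*) :: real \<Rightarrow> real \<Rightarrow> real" by unfold_locales (auto simp: algebra_simps)
  interpret P: vector_space_pair sc "(*) :: real \<Rightarrow> real \<Rightarrow> real" ..
  have sub: "V.subspace B" unfolding V.subspace_def using zero add scale by (auto simp: sc_def)
  obtain S where S: "S \<subseteq> B" "V.independent S" "B \<subseteq> V.span S" using V.maximal_independent_subset by blast
  have span: "V.span S = B" using S(1,3) V.span_minimal[OF S(1) sub] by blast
  have ind: "V.independent (insert c S)" using S(2) c span V.independent_insertI by blast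
  obtain F where F: "Vector_Spaces.linear sc (*) F" "\<forall>x\<in>insert c S. F x = (if x = c then 1 else 0)"
    using P.linear_independent_extend[OF ind, of "\<lambda>x. if x = c then 1 else 0"] by blast
  interpret F: Vector_Spaces.linear sc "(*)" F by (rule F(1))
  show ?thesis
  proof
    show "F (x + y) = F x + F y" for x y by (rule F.add)
    show "F (\<lambda>i. r * x i) = r * F x" for r x using F.scale[of r x] by (simp add: sc_def)
    have "F s = 0" if "s \<in> S" for s using F(2) that c S(1) by auto
    then show "F b = 0" if "b \<in> B" for b
      using F.eq_0_on_span[of S b] that span by blast
    show "F c \<noteq> 0" using F(2) by auto
  qed
qed

context group begin

text \<open>A functional that kills boundaries restricts to a cocycle on the simplices [g|h], by
  \<open>boundary_three_simplex\<close>. If that cocycle is the coboundary of \<open>b\<close>, the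
  value on a chain is \<open>b\<close> summed over the boundary of the chain, which is 0 for a
  cycle.\<close>

lemma H2_cycles_are_boundaries:
  assumes split: "\<And>f. is_cocycle G f \<Longrightarrow>
     \<exists>b. \<forall>g\<in>carrier G. \<forall>h\<in>carrier G. f g h = b g + b h - b (g \<otimes> h)"
    and c: "c \<in> bar_cycles G 2"
  shows "c \<in> (bar_boundaries G 2 :: ('a list \<Rightarrow> real) set)"
proof (rule ccontr)
  let ?B = "bar_boundaries G 2 :: ('a list \<Rightarrow> real) set"
  assume "c \<notin> ?B"
  then obtain F where F: "\<And>x y. F (x + y) = F x + F y" "\<And>r x. F (\<lambda>i. r * x i) = r * F x"
    "\<And>b. b \<in> ?B \<Longrightarrow> F b = 0" "F c \<noteq> 0"
    using separating_functional[of ?B c, OF bar_boundaries_zero bar_boundaries_add bar_boundaries_scale] by metis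
  have Fdiff: "F (x - y) = F x - F y" for x y
    using F(1)[of "x - y" y] by simp
  have F0: "F 0 = 0" using F(3)[OF bar_boundaries_zero] .
  have Fsum: "F (\<Sum>i\<in>A. x i) = (\<Sum>i\<in>A. F (x i))" for A :: "'a list set" and x
    by (induction A rule: infinite_finite_induct) (simp_all only: sum.infinite sum.empty sum.insert F0 F(1) simp_thms)
  define f where "f g h = F (single [g, h] 1)" for g h
  have "is_cocycle G f"
    unfolding is_cocycle_def f_def
    using F(3)[OF boundary_three_simplex[where m="1::real"]] unfolding F(1) Fdiff by blast
  then obtain b where b: "\<And>g h. g \<in> carrier G \<Longrightarrow> h \<in> carrier G \<Longrightarrow> f g h = b g + b h - b (g \<otimes> h)"
    using split by blast
  let ?S = "{xs. c xs \<noteq> 0}"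
  have fin: "finite ?S" and two: "\<And>xs. xs \<in> ?S \<Longrightarrow> length xs = 2 \<and> set xs \<subseteq> carrier G"
    and bd: "bar_boundary G c = (\<lambda>_. 0)"
    using c by (auto simp: bar_cycles_def bar_chains_def)
  \<comment> \<open>All faces of the simplices in \<open>c\<close>: a finite set over which the sum
    can be regrouped by faces, so that the boundary of \<open>c\<close> appears.\<close>
  define Y where "Y = (\<Union>xs\<in>?S. (\<lambda>i. bar_face G i xs) ` {0..length xs})"
  have finY: "finite Y" unfolding Y_def using fin by auto
  define b' where "b' ys = b (hd ys)" for ys
  have "F c = (\<Sum>xs\<in>?S. F (single xs (c xs)))"
    using Fsum[of "\<lambda>xs. single xs (c xs)" ?S] unfolding chain_eq_sum_single[OF fin, symmetric] .
  also have "\<dots> = (\<Sum>xs\<in>?S. \<Sum>i\<in>{0..length xs}. (if even i then c xs else - c xs) * b' (bar_face G i xs))"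
  proof (rule sum.cong[OF HOL.refl])
    fix xs assume "xs \<in> ?S"
    then have "length xs = 2" "set xs \<subseteq> carrier G" using two by blast+
    then obtain g h where xs: "xs = [g, h]" and gh: "g \<in> carrier G" "h \<in> carrier G"
      by (auto simp: numeral_2_eq_2 length_Suc_conv)
    have s: "single xs (c xs) = (\<lambda>ys. c xs * single xs 1 ys)" by (auto simp: single_def)
    have F: "F (single xs (c xs)) = c xs * f g h" unfolding s F(2) by (simp add: xs f_def)
    have "{0..length xs} = {0, 1, 2}" by (auto simp: xs)
    moreover have "bar_face G 0 xs = [h]" "bar_face G 1 xs = [g \<otimes> h]" "bar_face G 2 xs = [g]"
      by (simp_all add: xs bar_face_def)
    ultimately show "F (single xs (c xs)) = (\<Sum>i\<in>{0..length xs}. (if even i then c xs else - c xs) * b' (bar_face G i xs))"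
      by (simp add: F b[OF gh] b'_def algebra_simps)
  qed
  also have "\<dots> = (\<Sum>xs\<in>?S. \<Sum>i\<in>{0..length xs}. \<Sum>ys\<in>Y.
      b' ys * (if bar_face G i xs = ys then (if even i then c xs else - c xs) else 0))"
  proof (intro sum.cong HOL.refl)
    fix xs i assume "xs \<in> ?S" "i \<in> {0..length xs}"
    then have "bar_face G i xs \<in> Y" unfolding Y_def by blast
    then show "(if even i then c xs else - c xs) * b' (bar_face G i xs) =
      (\<Sum>ys\<in>Y. b' ys * (if bar_face G i xs = ys then (if even i then c xs else - c xs) else 0))"
      using finY by (simp add: if_distrib[of "(*) _"] sum.delta' mult.commute cong: if_cong)
  qed
  also have "\<dots> = (\<Sum>xs\<in>?S. \<Sum>ys\<in>Y. \<Sum>i\<in>{0..length xs}.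
      b' ys * (if bar_face G i xs = ys then (if even i then c xs else - c xs) else 0))"
    by (intro sum.cong HOL.refl sum.swap)
  also have "\<dots> = (\<Sum>ys\<in>Y. \<Sum>xs\<in>?S. \<Sum>i\<in>{0..length xs}.
      b' ys * (if bar_face G i xs = ys then (if even i then c xs else - c xs) else 0))"
    by (rule sum.swap)
  also have "\<dots> = (\<Sum>ys\<in>Y. b' ys * bar_boundary G c ys)"
    unfolding bar_boundary_def sum_distrib_left ..
  also have "\<dots> = 0" by (simp add: bd)
  finally show False using F(4) by simp
qed

lemma trivial_homologyI:
  assumes "bar_cycles G n \<subseteq> (bar_boundaries G n :: ('a list \<Rightarrow> 'm::comm_ring_1) set)"
  shows "\<exists>z. (group_homology G n :: ('a list \<Rightarrow> 'm) set set) = {z}"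
proof -
  let ?Z = "bar_cycles G n :: ('a list \<Rightarrow> 'm) set"
  let ?r = "{(c, d). c \<in> ?Z \<and> d \<in> ?Z \<and> c - d \<in> bar_boundaries G n}"
  have "bar_boundary G 0 = (\<lambda>_. 0::'m)" by (auto simp: bar_boundary_def)
  then have 0: "0 \<in> ?Z" by (auto simp: bar_cycles_def bar_chains_def)
  have "?r `` {c} = ?Z" if "c \<in> ?Z" for c
    using that assms by (auto intro: bar_boundaries_diff)
  then have "?Z // ?r = {?Z}" using 0 by (auto simp: quotient_def)
  then show ?thesis unfolding group_homology_def by blast
qed

end

text \<open>At the angle 0 the values are 0 and -pi/4. Distinctness lets
  \<open>cocycle_splits\<close> choose the lifts of the two generators independently.\<close>

lemma gens_distinct: "gen_p \<noteq> gen_q"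
proof
  assume "gen_p = gen_q"
  then have "gen_p 0 = gen_q 0" by simp
  then show False using lower_lift_0[of 1] by (simp add: gen_p_def gen_q_def upper_lift_0 arctan_one)
qed

theorem theorem1p5:
  shows "group Gamma_tilde
    \<and> finitely_presented Gamma_tilde
    \<and> finite (group_homology Gamma_tilde 1 :: ((real \<Rightarrow> real) list \<Rightarrow> int) set set)
    \<and> (\<exists>z. (group_homology Gamma_tilde 2 :: ((real \<Rightarrow> real) list \<Rightarrow> real) set set) = {z})"
proof (intro conjI)
  note r = gens_relation_1[folded Gamma_tilde_mult] gens_relation_2[folded Gamma_tilde_mult]
  show "group Gamma_tilde" by (rule group_Gamma_tilde)
  show "finitely_presented Gamma_tilde" by (rule finitely_presented_Gamma_tilde)
  show "finite (group_homology Gamma_tilde 1 :: ((real \<Rightarrow> real) list \<Rightarrow> int) set set)"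
    by (rule GT.finite_H1_of_relations[OF gens_carrier generate_Gamma_tilde r])
  have "\<exists>b. \<forall>g\<in>carrier Gamma_tilde. \<forall>h\<in>carrier Gamma_tilde. f g h = b g + b h - b (g \<otimes>\<^bsub>Gamma_tilde\<^esub> h)"
    if "is_cocycle Gamma_tilde f" for f
    by (rule GT.cocycle_splits[OF gens_carrier gens_distinct generate_Gamma_tilde r _ that])
      (simp only: Gamma_tilde_presentation)
  then have "bar_cycles Gamma_tilde 2 \<subseteq> (bar_boundaries Gamma_tilde 2 :: ((real \<Rightarrow> real) list \<Rightarrow> real) set)"
    by (intro subsetI GT.H2_cycles_are_boundaries)
  then show "\<exists>z. (group_homology Gamma_tilde 2 :: ((real \<Rightarrow> real) list \<Rightarrow> real) set set) = {z}"
    by (rule GT.trivial_homologyI)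
qed

end
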